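(* Let $G$ be a finite abelian group of order $n$ with distinct characters $\chi_1,\dots,\chi_n$ ($\chi_1$ principal), and let $\Gamma=\mathrm{BiCay}(G;R,L,T)$ be an integral bi-Cayley graph. Let $\lambda_1,\dots,\lambda_{2n}$ be as in the context, $H=\{k\mid \chi_k(T)=0,1\le k\le n\}$, $M_0=\gcd(\lambda_{2k}-\lambda_{2k-1}\mid 1\le k\le n,\ k\notin H)$ and $M_1=\gcd(\lambda_2-\lambda_{2k-1}\mid 1\le k\le n,\ k\notin H)$. Let $i\in\{0,1\}$, $g_p,g_q\in G$, and consider the vertices $(g_p)_i,(g_q)_i$ in the same part. Put $X=R$ if $i=0$ and $X=L$ if $i=1$; for $j\in\{-1,1\}$ put $\Omega_j=\{k\mid \chi_k(g_pg_q^{-1})=j,\ 1\le k\le n\}$; $M_{\emptyset,X}=\gcd(|X|-\chi_k(X)\mid 1\le k\le n)$; and $M_X=\gcd(\lambda_2-\chi_k(X)\mid k\in H)$ if $H\neq\emptyset$, $M_X=0$ if $H=\emptyset$. Then $\Gamma$ has perfect state transfer between $(g_p)_i$ and $(g_q)_i$ at time $t$ if and only if the following conditions hold: 1) $\chi_k(g_pg_q^{-1})=\pm1$ for each $1\le k\le n$; 2) there exists an integer $\mu$ such that 2.1) $v_2(\lambda_2-\lambda_{2k-1})=\mu$ for all $k\in\Omega_{-1}\setminus H$; $v_2(\lambda_2-\chi_k(X))=\mu$ if $T\neq\emptyset$, for all $k\in\Omega_{-1}\cap H$; $v_2(|X|-\chi_k(X))=\mu$ if $T=\emptyset$, for all $k\in\Omega_{-1}$;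 2.2) $v_2(\lambda_{2k}-\lambda_{2k-1})\ge\mu+1$ for all $k\notin H$; $v_2(\lambda_2-\lambda_{2k-1})\ge\mu+1$ for all $k\in\Omega_1\setminus H$; $v_2(\lambda_2-\chi_k(X))\ge\mu+1$ if $T\neq\emptyset$, for all $k\in\Omega_1\cap H$; $v_2(|X|-\chi_k(X))\ge\mu+1$ if $T=\emptyset$, for all $k\in\Omega_1$; 3) if $T\neq\emptyset$, then $t\in\{\frac{(1+2z)\pi}{\gcd(M_0,M_1,M_X)}\mid z\in\mathbb{Z}\}$ when $\Omega_{-1}\neq\emptyset$, and $t\in\{\frac{2\pi z}{\gcd(M_0,M_1,M_X)}\mid z\in\mathbb{Z}\}$ when $\Omega_{-1}=\emptyset$; 4) if $T=\emptyset$, then $t\in\{\frac{2\pi z}{M_{\emptyset,X}}\mid z\in\mathbb{Z}\}$ when $\Omega_{-1}=\emptyset$ or $\chi_k(X)=|X|$ for each $k\in\Omega_{-1}$, and $t\in\{\frac{(1+2z)\pi}{M_{\emptyset,X}}\mid z\in\mathbb{Z}\}$ otherwise.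
   Context: For a subset $S$ of a finite abelian group $G$ and a character $\chi$ of $G$, write $\chi(S)=\sum_{s\in S}\chi(s)$ (so $\chi(\emptyset)=0$). Given $R,L,T\subseteq G$ with $R=R^{-1}$, $L=L^{-1}$ and the identity not in $R\cup L$, $\mathrm{BiCay}(G;R,L,T)$ has vertex set $G_0\cup G_1$, $G_i=\{g_i\mid g\in G\}$ disjoint copies of $G$, and edges $\{h_0,g_0\}$ when $gh^{-1}\in R$, $\{h_1,g_1\}$ when $gh^{-1}\in L$, $\{h_0,g_1\}$ when $gh^{-1}\in T$. For $1\le k\le n$, $\lambda_{2k-1}=\frac{\chi_k(R)+\chi_k(L)-\sqrt{(\chi_k(R)-\chi_k(L))^2+4|\chi_k(T)|^2}}{2}$ and $\lambda_{2k}=\frac{\chi_k(R)+\chi_k(L)+\sqrt{(\chi_k(R)-\chi_k(L))^2+4|\chi_k(T)|^2}}{2}$ (the adjacency eigenvalues of $\Gamma$). The transfer matrix of a graph with adjacency matrix $A$ is $H(t)=\exp(-\mathrm{i}tA)$; PST between $u,v$ at time $t$ means $|H_{u,v}(t)|=1$. Integral means all adjacency eigenvalues are integers. $v_2$ is the 2-adic valuation on $\mathbb{Q}$ with $v_2(0)=\infty$; $\gcd(a,0)=a$.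
   Formalization: When T and X are both empty, M_{∅,X}=0 and the set {2πz/M_{∅,X}} in condition 4 is undefined; it is read here as the set of all real t (those with tM_{∅,X} an integer multiple of 2π). *)

theory Defs
  imports "HOL-Analysis.Analysis" "HOL-Algebra.Coset"
begin

type_synonym 'v ugraph = "'v set \<times> 'v set set"

(* The vertex g_i is the pair (g, i). *)
definition bicay :: "('a, 'm) monoid_scheme \<Rightarrow> 'a set \<Rightarrow> 'a set \<Rightarrow> 'a set \<Rightarrow> ('a \<times> nat) ugraph" where
  "bicay G R L T =
     (carrier G \<times> {0, 1},
        {{(h, 0), (g, 0)} | g h. g \<in> carrier G \<and> h \<in> carrier G \<and> g \<otimes>\<^bsub>G\<^esub> inv\<^bsub>G\<^esub> h \<in> R}
      \<union> {{(h, 1), (g, 1)} | g h. g \<in> carrier G \<and> h \<in> carrier G \<and> g \<otimes>\<^bsub>G\<^esub> inv\<^bsub>G\<^esub> h \<in> L}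
      \<union> {{(h, 0), (g, 1)} | g h. g \<in> carrier G \<and> h \<in> carrier G \<and> g \<otimes>\<^bsub>G\<^esub> inv\<^bsub>G\<^esub> h \<in> T})"

(* Matrices indexed by a finite set V are functions 'v => 'v => complex; only their
   entries on V matter. *)

definition adjacency :: "'v ugraph \<Rightarrow> 'v \<Rightarrow> 'v \<Rightarrow> complex" where
  "adjacency \<Gamma> u v = (if {u, v} \<in> snd \<Gamma> then 1 else 0)"

fun mat_power :: "'v set \<Rightarrow> ('v \<Rightarrow> 'v \<Rightarrow> complex) \<Rightarrow> nat \<Rightarrow> 'v \<Rightarrow> 'v \<Rightarrow> complex" where
  "mat_power V A 0 u v = (if u = v then 1 else 0)"
| "mat_power V A (Suc m) u v = (\<Sum>w\<in>V. A u w * mat_power V A m w v)"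

definition mat_exp :: "'v set \<Rightarrow> ('v \<Rightarrow> 'v \<Rightarrow> complex) \<Rightarrow> 'v \<Rightarrow> 'v \<Rightarrow> complex" where
  "mat_exp V A u v = (\<Sum>m. mat_power V A m u v / fact m)"

definition mat_eigenvalue :: "'v set \<Rightarrow> ('v \<Rightarrow> 'v \<Rightarrow> complex) \<Rightarrow> complex \<Rightarrow> bool" where
  "mat_eigenvalue V A \<theta> \<longleftrightarrow>
     (\<exists>x. (\<exists>u\<in>V. x u \<noteq> 0) \<and> (\<forall>u\<in>V. (\<Sum>v\<in>V. A u v * x v) = \<theta> * x u))"

definition integral_graph :: "'v ugraph \<Rightarrow> bool" where
  "integral_graph \<Gamma> \<longleftrightarrow> (\<forall>\<theta>. mat_eigenvalue (fst \<Gamma>) (adjacency \<Gamma>) \<theta> \<longrightarrow> \<theta> \<in> \<int>)"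

definition transfer_matrix :: "'v ugraph \<Rightarrow> real \<Rightarrow> 'v \<Rightarrow> 'v \<Rightarrow> complex" where
  "transfer_matrix \<Gamma> t = mat_exp (fst \<Gamma>) (\<lambda>u v. - \<i> * of_real t * adjacency \<Gamma> u v)"

definition perfect_state_transfer :: "'v ugraph \<Rightarrow> 'v \<Rightarrow> 'v \<Rightarrow> real \<Rightarrow> bool" where
  "perfect_state_transfer \<Gamma> u v t \<longleftrightarrow> cmod (transfer_matrix \<Gamma> t u v) = 1"

definition complex_mult_group :: "complex monoid" where
  "complex_mult_group = \<lparr>carrier = - {0}, monoid.mult = (*), one = 1\<rparr>"

definition group_character :: "('a, 'm) monoid_scheme \<Rightarrow> ('a \<Rightarrow> complex) \<Rightarrow> bool" where
  "group_character G chi \<longleftrightarrow> chi \<in> hom G complex_mult_group"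

definition char_sum :: "('a \<Rightarrow> complex) \<Rightarrow> 'a set \<Rightarrow> complex" where
  "char_sum chi S = (\<Sum>s\<in>S. chi s)"

(* For S closed under inversion, as R and L are, char_sum chi S is real. *)
definition real_char_sum :: "('a \<Rightarrow> complex) \<Rightarrow> 'a set \<Rightarrow> real" where
  "real_char_sum chi S = Re (char_sum chi S)"

(* The indices j = 2k - 1 and j = 2k both give k = (j + 1) div 2; the root is subtracted
   for odd j and added for even j. *)
definition bicay_eig :: "(nat \<Rightarrow> 'a \<Rightarrow> complex) \<Rightarrow> 'a set \<Rightarrow> 'a set \<Rightarrow> 'a set \<Rightarrow> nat \<Rightarrow> real" where
  "bicay_eig chi R L T j =
     (let k = (j + 1) div 2;
          r = real_char_sum (chi k) R;
          l = real_char_sum (chi k) L;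
          s = sqrt ((r - l)\<^sup>2 + 4 * (cmod (char_sum (chi k) T))\<^sup>2)
      in if odd j then (r + l - s) / 2 else (r + l + s) / 2)"

(* The 2-adic valuation of a rational number, given as a real; unspecified at irrationals. *)
definition v2 :: "real \<Rightarrow> ereal" where
  "v2 x = (if x = 0 then \<infinity>
           else ereal (of_int (THE m::int. \<exists>a b::int. odd a \<and> odd b \<and>
                                 x = 2 powi m * (of_int a / of_int b))))"

(* The gcd of a set of integers given as reals (non-integers would be ignored); it is 0 for
   the sets {} and {0}. *)
definition real_gcd :: "real set \<Rightarrow> int" where
  "real_gcd S = Gcd {m::int. of_int m \<in> S}"

definition odd_times :: "int \<Rightarrow> real set" where
  "odd_times M = {(1 + 2 * of_int z) * pi / of_int M | z::int. True}"

(* These are the solutions t of "t M is an integer multiple of 2 pi". For M = 0 that is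
   every real t, whereas the formula, with x / 0 = 0, would leave only t = 0. *)
definition even_times :: "int \<Rightarrow> real set" where
  "even_times M = (if M = 0 then UNIV else {2 * pi * of_int z / of_int M | z::int. True})"

end

theory Submission
  imports Defs "HOL-Algebra.Multiplicative_Group"
begin

text \<open>
  The characters block-diagonalise the adjacency matrix into Hermitian 2 x 2 blocks, so the
  entry of the transfer matrix between \<open>(p, i)\<close> and \<open>(q, i)\<close> is the average over \<open>k\<close> of
  \<open>\<chi>\<^sub>k(pq\<^sup>-\<^sup>1)\<close> times a convex combination of two phases, namely those of the eigenvalues of the
  \<open>k\<close>-th block (of the single phase of \<open>\<chi>\<^sub>k(X)\<close> if the block is diagonal). Such an average has
  modulus 1 only if all its terms coincide, and strict convexity then forces the two phases of
  each term to agree. As powers of the adjacency matrix are real, the same holds with the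
  conjugate characters, hence \<open>\<chi>\<^sub>k(pq\<^sup>-\<^sup>1) = \<plusminus>1\<close>. What remains is that \<open>t\<close> times certain integers is
  an even, and \<open>t\<close> times certain others an odd, multiple of \<open>\<pi>\<close>, which Bezout's identity
  turns into conditions on their gcd and their 2-adic valuations.
\<close>

section \<open>Extremal averages of complex numbers in the unit disc\<close>

text \<open>Equality case of the triangle inequality. After rotation by the conjugate of the mean
  \<open>c\<close>, every real part is at most 1 while their total is \<open>card K\<close>, so each
  of them is 1; the bound on the modulus then leaves no room for an imaginary part.\<close>

lemma sum_cmod_extremal:
  fixes z :: "'k \<Rightarrow> complex"
  assumes "finite K" "\<And>k. k \<in> K \<Longrightarrow> cmod (z k) \<le> 1"
    and "cmod (\<Sum>k\<in>K. z k) = real (card K)" "k \<in> K"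
  shows "z k = (\<Sum>k\<in>K. z k) / of_nat (card K)"
proof -
  define S where "S = (\<Sum>k\<in>K. z k)"
  have c: "card K > 0" using assms(1,4) by (auto simp: card_gt_0_iff)
  define c where "c = S / of_nat (card K)"
  have nc: "cmod c = 1"
    using assms(3) c by (simp add: c_def S_def norm_divide)
  have cc: "c * cnj c = 1" using nc by (metis complex_norm_square of_real_1 power_one)
  have le: "Re (z j * cnj c) \<le> 1" if "j \<in> K" for j
    using assms(2)[OF that] complex_Re_le_cmod[of "z j * cnj c"] nc by (simp add: norm_mult)
  have "(\<Sum>j\<in>K. z j * cnj c) = S * cnj c" by (simp add: S_def sum_distrib_right)
  also have "S = of_nat (card K) * c" using c by (simp add: c_def)
  also have "of_nat (card K) * c * cnj c = of_nat (card K)" using cc by (simp add: mult.assoc)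
  finally have "(\<Sum>j\<in>K. Re (z j * cnj c)) = real (card K)"
    by (metis Re_sum Re_complex_of_real of_real_of_nat_eq)
  then have "(\<Sum>j\<in>K. 1 - Re (z j * cnj c)) = 0" by (simp add: sum_subtractf)
  then have re: "Re (z k * cnj c) = 1"
    using sum_nonneg_eq_0_iff[of K "\<lambda>j. 1 - Re (z j * cnj c)"] le assms(1,4) by fastforce
  have "cmod (z k * cnj c) \<le> 1" using assms(2,4) nc by (simp add: norm_mult)
  then have "z k * cnj c = 1"
  proof -
    assume a: "cmod (z k * cnj c) \<le> 1"
    then have "(cmod (z k * cnj c))\<^sup>2 \<le> 1" by (simp add: power_le_one)
    then have "(Im (z k * cnj c))\<^sup>2 \<le> 0" using re by (simp only: cmod_power2) simp
    then have "Im (z k * cnj c) = 0" by simp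
    with re show ?thesis by (simp only: complex_eq_iff) simp
  qed
  then have "z k * (c * cnj c) = c" by (simp add: algebra_simps)
  then show ?thesis using cc by (simp add: c_def S_def)
qed

text \<open>Strict convexity of the disc in quantitative form: the difference between
  \<open>(a + b)\<^sup>2\<close> and the squared modulus of the combination is \<open>a * b\<close>
  times the squared modulus of \<open>u - v\<close>, and here both squares are 1.\<close>

lemma convex_combination_unit_eq:
  fixes u v :: complex and a b :: real
  assumes "cmod u = 1" "cmod v = 1" "a > 0" "b > 0" "a + b = 1"
    and "cmod (of_real a * u + of_real b * v) = 1"
  shows "u = v"
proof -
  have "(cmod (u - v))\<^sup>2 * (a * b) = 0"
  proof -
    have 1: "(Re u)\<^sup>2 + (Im u)\<^sup>2 = 1" "(Re v)\<^sup>2 + (Im v)\<^sup>2 = 1"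
      using assms(1,2) by (metis cmod_power2 power_one)+
    have "(a * Re u + b * Re v)\<^sup>2 + (a * Im u + b * Im v)\<^sup>2 = 1"
      using assms(6) cmod_power2[of "of_real a * u + of_real b * v"] by simp
    moreover have "(a * Re u + b * Re v)\<^sup>2 + (a * Im u + b * Im v)\<^sup>2
       = a\<^sup>2 * ((Re u)\<^sup>2 + (Im u)\<^sup>2) + b\<^sup>2 * ((Re v)\<^sup>2 + (Im v)\<^sup>2) + 2 * a * b * (Re u * Re v + Im u * Im v)"
      by (simp add: power2_eq_square algebra_simps)
    ultimately have 2: "a\<^sup>2 + b\<^sup>2 + 2 * a * b * (Re u * Re v + Im u * Im v) = 1"
      using 1 by simp
    have 3: "(a + b)\<^sup>2 = 1" using assms(5) by simp
    have "(cmod (u - v))\<^sup>2 = ((Re u)\<^sup>2 + (Im u)\<^sup>2) + ((Re v)\<^sup>2 + (Im v)\<^sup>2) - 2 * (Re u * Re v + Im u * Im v)"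
      unfolding cmod_power2 by (simp add: power2_eq_square algebra_simps)
    then have "(cmod (u - v))\<^sup>2 = 2 - 2 * (Re u * Re v + Im u * Im v)" using 1 by simp
    then have "(cmod (u - v))\<^sup>2 * (a * b) = 2 * a * b - 2 * a * b * (Re u * Re v + Im u * Im v)"
      by (simp only:) (simp add: algebra_simps)
    also have "\<dots> = 0" using 2 3 by (simp add: power2_eq_square algebra_simps)
    finally show ?thesis .
  qed
  then show ?thesis using assms(3,4) by simp
qed

text \<open>In the application \<open>w k\<close> is a character value and \<open>x k\<close>,
  \<open>y k\<close> are the phases of the two eigenvalues of a block. Hypothesis \<open>sym\<close>
  allows the extremal argument to be run with \<open>w\<close> and with its conjugate, which makes
  \<open>w k\<close> real; the index \<open>k0\<close> of the principal character identifies the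
  common value of all terms.\<close>

lemma cmod_sum_convex_phases_iff:
  fixes w x y :: "'k \<Rightarrow> complex" and a b :: "'k \<Rightarrow> real"
  assumes fin: "finite K"
    and w: "\<And>k. k \<in> K \<Longrightarrow> cmod (w k) = 1"
    and xy: "\<And>k. k \<in> K \<Longrightarrow> cmod (x k) = 1" "\<And>k. k \<in> K \<Longrightarrow> cmod (y k) = 1"
    and ab: "\<And>k. k \<in> K \<Longrightarrow> a k > 0" "\<And>k. k \<in> K \<Longrightarrow> b k > 0" "\<And>k. k \<in> K \<Longrightarrow> a k + b k = 1"
    and sym: "(\<Sum>k\<in>K. w k * (of_real (a k) * x k + of_real (b k) * y k))
            = (\<Sum>k\<in>K. cnj (w k) * (of_real (a k) * x k + of_real (b k) * y k))"
    and k0: "k0 \<in> K" "w k0 = 1"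
  shows "cmod (\<Sum>k\<in>K. w k * (of_real (a k) * x k + of_real (b k) * y k)) = real (card K)
     \<longleftrightarrow> (\<forall>k\<in>K. w k \<in> {1, -1} \<and> x k = y k \<and> w k * x k = x k0)"
    (is "cmod ?S = _ \<longleftrightarrow> ?rhs")
proof
  let ?f = "\<lambda>k. of_real (a k) * x k + of_real (b k) * y k"
  have f1: "cmod (?f k) \<le> 1" if "k \<in> K" for k
    using norm_triangle_ineq[of "of_real (a k) * x k" "of_real (b k) * y k"] xy ab that
    by (fastforce simp: norm_mult)
  assume L: "cmod ?S = real (card K)"
  have pos: "card K > 0" using k0 fin by (auto simp: card_gt_0_iff)
  define c where "c = ?S / of_nat (card K)"
  have nc: "cmod c = 1" using L pos by (simp add: c_def norm_divide)
  have 1: "w k * ?f k = c" if "k \<in> K" for k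
    unfolding c_def
    by (rule sum_cmod_extremal[OF fin _ L that]) (use f1 w in \<open>simp add: norm_mult\<close>)
  have 2: "cnj (w k) * ?f k = c" if "k \<in> K" for k
    unfolding c_def sym
    by (rule sum_cmod_extremal[OF fin _ _ that]) (use f1 w L sym in \<open>simp_all add: norm_mult\<close>)
  have main: "w k \<in> {1, -1} \<and> x k = y k \<and> w k * x k = c" if k: "k \<in> K" for k
  proof -
    have nf: "cmod (?f k) = 1"
      using 1[OF k] w[OF k] nc by (metis mult_1 norm_mult)
    then have xyk: "x k = y k" using convex_combination_unit_eq xy ab k by blast
    have "?f k = of_real (a k + b k) * x k" by (simp add: xyk algebra_simps)
    then have fx: "?f k = x k" using ab(3)[OF k] by simp
    \<comment> \<open>Both products equal \<open>c\<close>, and \<open>?f k\<close> cancels since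
      its modulus is 1; a real number of modulus 1 is a sign.\<close>
    have "w k = cnj (w k)" using 1[OF k] 2[OF k] nf
      by (metis mult_right_cancel norm_zero zero_neq_one)
    then have "w k * w k = 1" using w[OF k] by (metis complex_norm_square of_real_1 power_one)
    then have "w k \<in> {1, -1}" by (simp add: square_eq_1_iff)
    then show ?thesis using xyk 1[OF k] fx by simp
  qed
  moreover have "c = x k0" using main[OF k0(1)] k0(2) by auto
  ultimately show ?rhs by blast
next
  assume R: ?rhs
  have "w k * (of_real (a k) * x k + of_real (b k) * y k) = x k0" if k: "k \<in> K" for k
  proof -
    have "of_real (a k) * x k + of_real (b k) * y k = of_real (a k + b k) * x k"
      using R k by (simp add: algebra_simps)
    then have "of_real (a k) * x k + of_real (b k) * y k = x k" using ab(3)[OF k] by simp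
    then show ?thesis using R k by metis
  qed
  then have "?S = of_nat (card K) * x k0" by simp
  then show "cmod ?S = real (card K)" using xy(1)[OF k0(1)] by (simp add: norm_mult)
qed

section \<open>Phases 1 and -1, and the 2-adic valuation of integers\<close>

lemma cis_eq_one_iff: "cis x = 1 \<longleftrightarrow> (\<exists>z::int. x = 2 * pi * of_int z)"
  by (simp add: cis_conv_exp exp_eq_1 mult_ac)

lemma cis_eq_minus_one_iff: "cis x = -1 \<longleftrightarrow> (\<exists>z::int. x = (1 + 2 * of_int z) * pi)"
proof -
  have "cis x = -1 \<longleftrightarrow> cis (x - pi) = 1"
    by (simp add: complex_eq_iff)
  also have "\<dots> \<longleftrightarrow> (\<exists>z::int. x - pi = 2 * pi * of_int z)" by (rule cis_eq_one_iff)
  also have "\<dots> \<longleftrightarrow> (\<exists>z::int. x = (1 + 2 * of_int z) * pi)" by (simp add: algebra_simps)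
  finally show ?thesis .
qed

text \<open>With \<open>m \<le> m'\<close> without loss of generality, clearing denominators equates
  an odd integer with \<open>2 ^ (m' - m)\<close> times another integer, so the exponent is 0. This
  is what makes the definite description in \<open>v2\<close> well defined.\<close>

lemma power_int_2_odd_quotient_unique:
  fixes m m' a b a' b' :: int
  assumes "odd a" "odd b" "odd a'" "odd b'"
    and "(2::real) powi m * (of_int a / of_int b) = 2 powi m' * (of_int a' / of_int b')"
  shows "m = m'"
  using assms
proof (induction m m' arbitrary: a b a' b' rule: linorder_wlog)
  case (le m m')
  have nz: "b \<noteq> 0" "b' \<noteq> 0" using le by auto
  define e where "e = nat (m' - m)"
  have "(2::real) powi m' = 2 powi m * 2 ^ e"
    using le(1) by (simp add: e_def power_int_diff flip: power_int_of_nat)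
  then have "of_int a / of_int b = 2 ^ e * (of_int a' / of_int b' :: real)"
    using le(6) by (simp add: mult.assoc power_int_not_zero flip: times_divide_eq_right)
  then have "of_int (a * b') = (of_int (2 ^ e * a' * b) :: real)"
    using nz by (simp add: field_simps)
  then have "a * b' = 2 ^ e * a' * b" by (simp only: of_int_eq_iff)
  moreover have "odd (a * b')" using le by simp
  ultimately have "e = 0" by (cases e) auto
  then show ?case using le(1) by (simp add: e_def)
next
  case (sym m m')
  then show ?case by metis
qed

lemma v2_eqI:
  assumes "odd a" "odd b" "x = 2 powi m * (of_int a / of_int b)"
  shows "v2 x = ereal (of_int m)"
proof -
  have "x \<noteq> 0" using assms by auto
  moreover have "(THE m::int. \<exists>a b::int. odd a \<and> odd b \<and> x = 2 powi m * (of_int a / of_int b)) = m"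
    using assms power_int_2_odd_quotient_unique by (intro the_equality) blast+
  ultimately show ?thesis by (simp add: v2_def)
qed

lemma v2_power_times_odd:
  assumes "odd a"
  shows "v2 (of_int (2 ^ e * a)) = ereal (of_int (int e))"
  by (rule v2_eqI[OF assms, of 1]) auto

lemma int_power_2_times_oddE:
  fixes d :: int
  assumes "d \<noteq> 0"
  obtains e a where "d = 2 ^ e * a" "odd a"
proof -
  from assms obtain a where "d = 2 ^ multiplicity 2 d * a" "odd a"
    by (rule multiplicity_decompose') auto
  then show ?thesis by (rule that)
qed

text \<open>Every nonzero integer splits into a power of two and an odd part, and a finite valuation
  rules out 0. In this form valuations become statements about parity.\<close>

lemma v2_of_int_eq_iff:
  "v2 (of_int d) = ereal (of_int m) \<longleftrightarrow> (\<exists>e a. m = int e \<and> d = 2 ^ e * a \<and> odd a)"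
proof
  assume v: "v2 (of_int d) = ereal (of_int m)"
  then have "d \<noteq> 0" by (auto simp: v2_def)
  then obtain e a where ea: "d = 2 ^ e * a" "odd a" by (rule int_power_2_times_oddE)
  then have "m = int e" using v v2_power_times_odd[OF ea(2), of e] by simp
  with ea show "\<exists>e a. m = int e \<and> d = 2 ^ e * a \<and> odd a" by blast
next
  assume "\<exists>e a. m = int e \<and> d = 2 ^ e * a \<and> odd a"
  then show "v2 (of_int d) = ereal (of_int m)" using v2_power_times_odd by blast
qed

text \<open>The case \<open>d = 0\<close> is included: its infinite valuation matches divisibility
  by all powers of two. Natural thresholds suffice, as only 0 and successors \<open>Suc e\<close>
  occur below.\<close>

lemma v2_of_int_ge_iff:
  "v2 (of_int d) \<ge> ereal (of_int (int e)) \<longleftrightarrow> 2 ^ e dvd d"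
proof (cases "d = 0")
  case True
  then show ?thesis by (simp add: v2_def)
next
  case False
  then obtain f a where fa: "d = 2 ^ f * a" "odd a" by (rule int_power_2_times_oddE)
  have "2 ^ e dvd d \<longleftrightarrow> e \<le> f"
  proof
    assume "2 ^ e dvd d"
    show "e \<le> f"
    proof (rule ccontr)
      assume "\<not> e \<le> f"
      then have "(2::int) ^ Suc f dvd 2 ^ e" by (intro le_imp_power_dvd) simp
      with \<open>2 ^ e dvd d\<close> have "2 ^ f * 2 dvd 2 ^ f * a" using fa(1) by (metis dvd_trans power_Suc2)
      then show False using fa(2) by simp
    qed
  next
    assume "e \<le> f"
    then show "2 ^ e dvd d" using fa(1) by (simp add: le_imp_power_dvd)
  qed
  then show ?thesis using v2_power_times_odd[OF fa(2), of f] fa(1) by simp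
qed

section \<open>Gcds and simultaneous even or odd multiples of pi\<close>

lemma Gcd_union_int: "Gcd (A \<union> B) = gcd (Gcd A) (Gcd B)" for A B :: "int set"
proof (rule zdvd_antisym_nonneg)
  show "Gcd (A \<union> B) dvd gcd (Gcd A) (Gcd B)"
    by (intro gcd_greatest Gcd_greatest) (simp_all add: Gcd_dvd)
  show "gcd (Gcd A) (Gcd B) dvd Gcd (A \<union> B)"
    by (rule Gcd_greatest) (metis Gcd_dvd Un_iff dvd_trans gcd_dvd1 gcd_dvd2)
qed simp_all

text \<open>The integers \<open>d\<close> for which \<open>t * d\<close> is an integer multiple of
  \<open>c\<close> are closed under integer combinations, and by Bezout the gcd is such a
  combination.\<close>

lemma mult_Gcd_int_multiple:
  fixes D :: "int set"
  assumes "finite D" "\<And>d. d \<in> D \<Longrightarrow> \<exists>z::int. t * of_int d = c * of_int z"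
  shows "\<exists>z::int. t * of_int (Gcd D) = (c::real) * of_int z"
  using assms
proof (induction D rule: finite_induct)
  case empty
  then show ?case by (auto intro: exI[of _ 0])
next
  case (insert d D)
  obtain x where x: "t * of_int d = c * of_int x" using insert by auto
  obtain y where y: "t * of_int (Gcd D) = c * of_int y" using insert by auto
  obtain u v where uv: "u * d + v * Gcd D = gcd d (Gcd D)" using bezout_int by blast
  have "t * of_int (Gcd (insert d D)) = of_int u * (t * of_int d) + of_int v * (t * of_int (Gcd D))"
    by (simp flip: uv add: algebra_simps)
  also have "\<dots> = c * of_int (u * x + v * y)" unfolding x y by (simp add: algebra_simps)
  finally show ?case by blast
qed

text \<open>Here \<open>A\<close> collects the integers that must produce the phase 1 and
  \<open>B\<close> those that must produce -1. With \<open>M\<close> the gcd of all of them and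
  \<open>B\<close> nonempty, both sides say that \<open>t * M\<close> is an odd multiple of pi, that
  the cofactors of \<open>M\<close> in \<open>B\<close> are odd and that those in \<open>A\<close>
  are even; the valuation conditions encode these parities, \<open>\<mu>\<close> being the valuation
  of \<open>M\<close>.\<close>

lemma even_odd_multiples_of_pi_iff:
  fixes A B :: "int set" and t :: real
  assumes fin: "finite A" "finite B"
  shows "(\<forall>a\<in>A. \<exists>z::int. t * of_int a = 2 * pi * of_int z) \<and>
         (\<forall>b\<in>B. \<exists>z::int. t * of_int b = (1 + 2 * of_int z) * pi)
     \<longleftrightarrow> (\<exists>\<mu>::int. (\<forall>b\<in>B. v2 (of_int b) = ereal (of_int \<mu>)) \<and>
                   (\<forall>a\<in>A. v2 (of_int a) \<ge> ereal (of_int (\<mu> + 1)))) \<and>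
         t \<in> (if B = {} then even_times (Gcd (A \<union> B)) else odd_times (Gcd (A \<union> B)))"
    (is "?lhs \<longleftrightarrow> ?v2 \<and> ?t")
proof (cases "B = {}")
  case True
  \<comment> \<open>With \<open>B\<close> empty, \<open>\<mu>\<close> is only a lower bound, and -1
    turns it into the bound 0, which every integer meets.\<close>
  have "?v2" by (rule exI[of _ "-1"]) (use True v2_of_int_ge_iff[of 0] in auto)
  moreover have "(\<forall>a\<in>A. \<exists>z::int. t * of_int a = 2 * pi * of_int z) \<longleftrightarrow>
      (\<exists>z::int. t * of_int (Gcd A) = 2 * pi * of_int z)"
  proof
    assume "\<exists>z::int. t * of_int (Gcd A) = 2 * pi * of_int z"
    then obtain z::int where z: "t * of_int (Gcd A) = 2 * pi * of_int z" by blast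
    show "\<forall>a\<in>A. \<exists>z::int. t * of_int a = 2 * pi * of_int z"
    proof
      fix a assume "a \<in> A"
      then obtain c where "a = Gcd A * c" using Gcd_dvd by (metis dvd_def)
      then have "t * of_int a = t * of_int (Gcd A) * of_int c" by simp
      then have "t * of_int a = 2 * pi * of_int (z * c)" unfolding z by simp
      then show "\<exists>z::int. t * of_int a = 2 * pi * of_int z" by blast
    qed
  qed (use mult_Gcd_int_multiple[OF fin(1)] in blast)
  \<comment> \<open>For gcd 0 the left side holds for every \<open>t\<close>, in agreement with the
    special case in \<open>even_times\<close>.\<close>
  moreover have "(\<exists>z::int. t * of_int (Gcd A) = 2 * pi * of_int z) \<longleftrightarrow> t \<in> even_times (Gcd A)"
    by (auto simp: even_times_def field_simps intro: exI[of _ 0])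
  ultimately show ?thesis using True by simp
next
  case False
  then obtain b0 where b0: "b0 \<in> B" by blast
  define M where "M = Gcd (A \<union> B)"
  have dvd: "M dvd d" if "d \<in> A \<union> B" for d unfolding M_def using that by (rule Gcd_dvd)
  show ?thesis
  proof
    assume L: ?lhs
    have "\<exists>z::int. t * of_int d = pi * of_int z" if "d \<in> A \<union> B" for d
    proof -
      from L that obtain z :: int where "t * of_int d = 2 * pi * of_int z \<or> t * of_int d = (1 + 2 * of_int z) * pi"
        by blast
      then have "t * of_int d = pi * of_int (2 * z) \<or> t * of_int d = pi * of_int (1 + 2 * z)"
        by (simp add: mult_ac)
      then show ?thesis by blast
    qed
    then obtain m :: int where m: "t * of_int M = pi * of_int m"
      using mult_Gcd_int_multiple[of "A \<union> B" t pi] fin unfolding M_def by blast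
    have mult: "t * of_int (M * c) = pi * of_int (m * c)" for c
      using m by simp
    have mB: "odd (m * c)" if bc: "b \<in> B" "b = M * c" for b c
    proof -
      obtain z :: int where "t * of_int b = (1 + 2 * of_int z) * pi" using L bc by blast
      then have "pi * of_int (m * c) = pi * of_int (1 + 2 * z)" using mult[of c] bc by (simp add: mult_ac)
      then have "m * c = 1 + 2 * z" by (simp only: mult_cancel_left of_int_eq_iff) simp
      then show ?thesis by simp
    qed
    have mA: "even (m * c)" if bc: "a \<in> A" "a = M * c" for a c
    proof -
      obtain z :: int where "t * of_int a = 2 * pi * of_int z" using L bc by blast
      then have "pi * of_int (m * c) = pi * of_int (2 * z)" using mult[of c] bc by (simp add: mult_ac)
      then have "m * c = 2 * z" by (simp only: mult_cancel_left of_int_eq_iff) simp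
      then show ?thesis by simp
    qed
    \<comment> \<open>A single element of \<open>B\<close> makes \<open>m\<close> odd, hence
      nonzero, and so excludes \<open>M = 0\<close>.\<close>
    obtain c0 where c0: "b0 = M * c0" using dvd b0 by blast
    have modd: "odd m" using mB[OF b0 c0] by simp
    have M0: "M \<noteq> 0" using m modd by auto
    then obtain e o' where eo: "M = 2 ^ e * o'" "odd o'" by (rule int_power_2_times_oddE)
    have "v2 (of_int b) = ereal (of_int (int e))" if b: "b \<in> B" for b
    proof -
      obtain c where c: "b = M * c" using dvd b by blast
      then have "odd c" using mB[OF b c] by simp
      then show ?thesis unfolding v2_of_int_eq_iff using eo c by (intro exI[of _ e] exI[of _ "o' * c"]) auto
    qed
    moreover have "v2 (of_int a) \<ge> ereal (of_int (int e + 1))" if a: "a \<in> A" for a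
    proof -
      obtain c where c: "a = M * c" using dvd a by blast
      then have "even c" using mA[OF a c] modd by simp
      then obtain c' where "c = 2 * c'" by blast
      then have "a = 2 ^ Suc e * (o' * c')" using c eo by simp
      then have "2 ^ Suc e dvd a" by simp
      then show ?thesis using v2_of_int_ge_iff[of "Suc e" a] by (simp add: add.commute)
    qed
    ultimately have ?v2 by blast
    moreover have "t \<in> odd_times M"
    proof -
      obtain z where "m = 1 + 2 * z" using modd by (metis oddE add.commute)
      then have "t = (1 + 2 * of_int z) * pi / of_int M" using m M0 by (simp add: field_simps)
      then show ?thesis unfolding odd_times_def by blast
    qed
    ultimately show "?v2 \<and> ?t" using False by (simp add: M_def)
  next
    assume R: "?v2 \<and> ?t"
    then obtain \<mu> :: int where vB: "\<And>b. b \<in> B \<Longrightarrow> v2 (of_int b) = ereal (of_int \<mu>)"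
      and vA: "\<And>a. a \<in> A \<Longrightarrow> v2 (of_int a) \<ge> ereal (of_int (\<mu> + 1))" by blast
    obtain e a0 where e: "\<mu> = int e" "b0 = 2 ^ e * a0" "odd a0"
      using vB[OF b0] unfolding v2_of_int_eq_iff by blast
    have eA: "2 ^ Suc e dvd a" if "a \<in> A" for a
      using vA[OF that] v2_of_int_ge_iff[of "Suc e" a] e by (simp add: add.commute)
    have eB: "\<exists>c. b = 2 ^ e * c \<and> odd c" if "b \<in> B" for b
      using vB[OF that] unfolding v2_of_int_eq_iff e by auto
    \<comment> \<open>The factor \<open>2 ^ e\<close> divides all of \<open>A\<close> and
      \<open>B\<close>, and \<open>b0\<close> contains no higher power of two, so \<open>M\<close>
      is \<open>2 ^ e\<close> times an odd number. Dividing by \<open>M\<close> therefore removes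
      exactly the factor \<open>2 ^ e\<close>, up to odd factors.\<close>
    have "2 ^ e dvd M" unfolding M_def
    proof (rule Gcd_greatest)
      fix d assume "d \<in> A \<union> B"
      then show "2 ^ e dvd d" using eA eB by (metis Un_iff dvd_triv_left dvd_mult_left power_Suc2)
    qed
    then obtain o' where o': "M = 2 ^ e * o'" by blast
    have cB: "odd o' \<and> odd c" if bc: "b \<in> B" "b = M * c" for b c
    proof -
      obtain c' where "b = 2 ^ e * c'" "odd c'" using eB bc by blast
      then have "odd (o' * c)" using bc o' by (simp add: mult.assoc)
      then show ?thesis by simp
    qed
    have oodd: "odd o'" using cB b0 dvd by blast
    have M0: "M \<noteq> 0" using oodd o' by auto
    have "t \<in> odd_times M" using R False by (simp add: M_def)
    then obtain z :: int where "t = (1 + 2 * of_int z) * pi / of_int M" unfolding odd_times_def by blast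
    then have tM: "t * of_int (M * c) = (1 + 2 * of_int z) * pi * of_int c" for c using M0 by simp
    have "\<exists>z::int. t * of_int a = 2 * pi * of_int z" if a: "a \<in> A" for a
    proof -
      obtain c where c: "a = M * c" using dvd a by blast
      have "2 ^ e * 2 dvd 2 ^ e * (o' * c)" using eA[OF a] c o' by (simp add: mult_ac)
      then have "even c" using oodd by simp
      then obtain c' where c': "c = 2 * c'" by blast
      have "t * of_int a = 2 * pi * of_int ((1 + 2 * z) * c')"
        unfolding c tM unfolding c' by (simp add: algebra_simps)
      then show ?thesis by blast
    qed
    moreover have "\<exists>z::int. t * of_int b = (1 + 2 * of_int z) * pi" if b: "b \<in> B" for b
    proof -
      obtain c where c: "b = M * c" using dvd b by blast
      then have "odd c" using cB b by blast
      then obtain c' where c': "c = 2 * c' + 1" by (rule oddE)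
      have "t * of_int b = (1 + 2 * of_int (z + c' + 2 * z * c')) * pi"
        unfolding c tM unfolding c' by (simp add: algebra_simps)
      then show ?thesis by blast
    qed
    ultimately show ?lhs by blast
  qed
qed

section \<open>Characters of a finite abelian group and their orthogonality\<close>

text \<open>Having as many distinct characters as group elements makes the table square, so that
  column orthogonality can be derived from row orthogonality.\<close>

locale character_table = comm_group G for G (structure) +
  fixes chi :: "nat \<Rightarrow> 'a \<Rightarrow> complex" and n :: nat
  assumes fin: "finite (carrier G)" and order_eq: "order G = n"
    and characters: "\<forall>k\<in>{1..n}. group_character G (chi k)"
    and distinct: "\<forall>k\<in>{1..n}. \<forall>l\<in>{1..n}. k \<noteq> l \<longrightarrow> (\<exists>g\<in>carrier G. chi k g \<noteq> chi l g)"
begin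

lemma chi_mult:
  "k \<in> {1..n} \<Longrightarrow> g \<in> carrier G \<Longrightarrow> h \<in> carrier G \<Longrightarrow> chi k (g \<otimes> h) = chi k g * chi k h"
  using characters by (auto simp: group_character_def complex_mult_group_def hom_def)

lemma chi_nonzero: "k \<in> {1..n} \<Longrightarrow> g \<in> carrier G \<Longrightarrow> chi k g \<noteq> 0"
  using characters by (auto simp: group_character_def complex_mult_group_def hom_def)

lemma chi_one: "k \<in> {1..n} \<Longrightarrow> chi k \<one> = 1"
  using chi_mult[of k \<one> \<one>] chi_nonzero[of k \<one>] by simp

lemma n_pos: "n > 0"
  using order_eq fin one_closed unfolding order_def by (metis card_gt_0_iff empty_iff)

lemma chi_pow: "k \<in> {1..n} \<Longrightarrow> g \<in> carrier G \<Longrightarrow> chi k (g [^] (m::nat)) = chi k g ^ m"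
  by (induction m) (simp_all add: chi_one chi_mult)

text \<open>The group order annihilates every element, so character values are \<open>n\<close>-th
  roots of unity.\<close>

lemma cmod_chi: "k \<in> {1..n} \<Longrightarrow> g \<in> carrier G \<Longrightarrow> cmod (chi k g) = 1"
proof -
  assume k: "k \<in> {1..n}" and g: "g \<in> carrier G"
  have "chi k g ^ n = 1" using chi_pow[OF k g, of n] pow_order_eq_1[OF g] chi_one[OF k] order_eq by simp
  then have "cmod (chi k g) ^ n = 1" by (metis norm_one norm_power)
  then show ?thesis using n_pos power_eq_imp_eq_base[of "cmod (chi k g)" n 1] by simp
qed

lemma chi_mult_cnj: "k \<in> {1..n} \<Longrightarrow> g \<in> carrier G \<Longrightarrow> chi k g * cnj (chi k g) = 1"
  using cmod_chi by (metis complex_norm_square of_real_1 power_one)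

lemma chi_inv: "k \<in> {1..n} \<Longrightarrow> g \<in> carrier G \<Longrightarrow> chi k (inv g) = cnj (chi k g)"
  using chi_mult[of k g "inv g"] chi_one chi_mult_cnj chi_nonzero
  by (metis inv_closed mult_left_cancel r_inv)

lemma sum_translate:
  assumes "h \<in> carrier G"
  shows "(\<Sum>g\<in>carrier G. f (h \<otimes> g)) = (\<Sum>g\<in>carrier G. f g)"
  by (rule sum.reindex_bij_witness[of _ "\<lambda>g. inv h \<otimes> g" "\<lambda>g. h \<otimes> g"])
     (use assms in \<open>auto simp flip: m_assoc\<close>)

text \<open>For distinct characters, translation by an element \<open>h\<close> at which they differ
  multiplies the sum by a number other than 1 without changing it.\<close>

lemma row_orthogonality:
  assumes k: "k \<in> {1..n}" and l: "l \<in> {1..n}"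
  shows "(\<Sum>g\<in>carrier G. cnj (chi k g) * chi l g) = (if k = l then of_nat n else 0)"
proof (cases "k = l")
  case True
  have "(\<Sum>g\<in>carrier G. cnj (chi k g) * chi l g) = (\<Sum>g\<in>carrier G. 1)"
    using True chi_mult_cnj[OF k] by (intro sum.cong) (auto simp: mult.commute)
  then show ?thesis using True order_eq by (simp add: order_def)
next
  case False
  then obtain h where h: "h \<in> carrier G" "chi k h \<noteq> chi l h" using distinct k l by blast
  let ?S = "\<Sum>g\<in>carrier G. cnj (chi k g) * chi l g"
  have "?S = (\<Sum>g\<in>carrier G. cnj (chi k (h \<otimes> g)) * chi l (h \<otimes> g))"
    by (rule sum_translate[OF h(1), symmetric])
  also have "\<dots> = (\<Sum>g\<in>carrier G. (cnj (chi k h) * chi l h) * (cnj (chi k g) * chi l g))"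
    by (intro sum.cong) (use h k l in \<open>auto simp: chi_mult mult_ac\<close>)
  also have "\<dots> = (cnj (chi k h) * chi l h) * ?S" by (simp add: sum_distrib_left)
  finally have "(1 - cnj (chi k h) * chi l h) * ?S = 0" by (simp add: algebra_simps)
  moreover have "cnj (chi k h) * chi l h \<noteq> 1"
  proof
    assume "cnj (chi k h) * chi l h = 1"
    then have "chi k h * (cnj (chi k h) * chi l h) = chi k h" by simp
    then have "chi l h = chi k h" using chi_mult_cnj[OF k h(1)] by (simp flip: mult.assoc)
    then show False using h by simp
  qed
  ultimately show ?thesis using False by simp
qed

text \<open>The kernel \<open>(1/n) \<Sum>\<^sub>k \<chi>\<^sub>k(g) \<chi>\<^sub>k(h)\<^sup>*\<close> is idempotent and Hermitian with diagonal entries 1, so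
  the squared moduli in each of its rows add up to 1 and the off-diagonal entries vanish.\<close>

lemma column_orthogonality:
  assumes g: "g \<in> carrier G" and h: "h \<in> carrier G"
  shows "(\<Sum>k=1..n. chi k g * cnj (chi k h)) = (if g = h then of_nat n else 0)"
proof (cases "g = h")
  case True
  have "(\<Sum>k=1..n. chi k g * cnj (chi k h)) = (\<Sum>k=1..n. 1)"
    using True chi_mult_cnj g by (intro sum.cong) auto
  then show ?thesis using True by simp
next
  case False
  define K where "K = (\<lambda>x. \<Sum>k=1..n. chi k g * cnj (chi k x))"
  have Kg: "K g = of_nat n"
    unfolding K_def using chi_mult_cnj[OF _ g] by simp
  have "(\<Sum>x\<in>carrier G. K x * cnj (K x)) =
      (\<Sum>x\<in>carrier G. \<Sum>k=1..n. \<Sum>l=1..n. (chi k g * cnj (chi l g)) * (cnj (chi k x) * chi l x))"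
    unfolding K_def cnj_sum sum_product by (simp add: mult_ac)
  also have "\<dots> = (\<Sum>k=1..n. \<Sum>x\<in>carrier G. \<Sum>l=1..n. (chi k g * cnj (chi l g)) * (cnj (chi k x) * chi l x))"
    by (rule sum.swap)
  also have "\<dots> = (\<Sum>k=1..n. \<Sum>l=1..n. (chi k g * cnj (chi l g)) * (\<Sum>x\<in>carrier G. cnj (chi k x) * chi l x))"
    by (subst sum.swap) (simp add: sum_distrib_left)
  also have "\<dots> = (\<Sum>k=1..n. \<Sum>l=1..n. if k = l then chi k g * cnj (chi l g) * of_nat n else 0)"
    by (intro sum.cong refl) (simp add: row_orthogonality)
  also have "\<dots> = (\<Sum>k=1..n. of_nat n)"
    by (intro sum.cong refl) (simp add: chi_mult_cnj g)
  also have "\<dots> = of_nat (n * n)" by simp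
  finally have "complex_of_real (\<Sum>x\<in>carrier G. (cmod (K x))\<^sup>2) = of_real (real (n * n))"
    by (simp only: of_real_sum complex_norm_square of_real_of_nat_eq)
  then have "(\<Sum>x\<in>carrier G. (cmod (K x))\<^sup>2) = real (n * n)" by (simp only: of_real_eq_iff)
  moreover have "(\<Sum>x\<in>carrier G. (cmod (K x))\<^sup>2) = (cmod (K g))\<^sup>2 + (\<Sum>x\<in>carrier G - {g}. (cmod (K x))\<^sup>2)"
    using fin g by (simp add: sum.remove)
  ultimately have "(\<Sum>x\<in>carrier G - {g}. (cmod (K x))\<^sup>2) = 0"
    using Kg by (simp add: power2_eq_square)
  then have "K h = 0" using fin h False by (subst (asm) sum_nonneg_eq_0_iff) auto
  then show ?thesis using False by (simp add: K_def)
qed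

text \<open>Replacing \<open>h\<close> by \<open>g \<otimes> h\<close> reduces the membership test,
  by commutativity, to \<open>h \<in> S\<close> and splits off \<open>chi k g\<close>. Thus
  characters are eigenvectors of every translation-invariant matrix.\<close>

lemma sum_chi_quotient:
  assumes S: "S \<subseteq> carrier G" and k: "k \<in> {1..n}" and g: "g \<in> carrier G"
  shows "(\<Sum>h\<in>carrier G. (if h \<otimes> inv g \<in> S then 1 else 0) * chi k h) = char_sum (chi k) S * chi k g"
proof -
  have "(\<Sum>h\<in>carrier G. (if h \<otimes> inv g \<in> S then 1 else 0) * chi k h)
     = (\<Sum>h\<in>carrier G. (if g \<otimes> h \<otimes> inv g \<in> S then 1 else 0) * chi k (g \<otimes> h))"
    by (rule sum_translate[OF g, symmetric])
  also have "\<dots> = (\<Sum>h\<in>carrier G. if h \<in> S then chi k h * chi k g else 0)"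
  proof (intro sum.cong refl)
    fix h assume h: "h \<in> carrier G"
    have "g \<otimes> h \<otimes> inv g = h" using g h by (simp add: m_comm[of g h] m_assoc)
    then show "(if g \<otimes> h \<otimes> inv g \<in> S then 1 else 0) * chi k (g \<otimes> h)
        = (if h \<in> S then chi k h * chi k g else 0)"
      using g h k by (simp add: chi_mult)
  qed
  also have "\<dots> = (\<Sum>h\<in>S. chi k h * chi k g)"
    using S fin by (simp add: sum.inter_restrict[symmetric] Int_absorb1)
  finally show ?thesis by (simp add: char_sum_def sum_distrib_right)
qed

lemma char_sum_inv:
  assumes S: "S \<subseteq> carrier G" and k: "k \<in> {1..n}"
  shows "char_sum (chi k) (set_inv S) = cnj (char_sum (chi k) S)"
proof -
  have "set_inv S = (\<lambda>s. inv s) ` S" by (auto simp: SET_INV_def)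
  moreover have "inj_on (\<lambda>s. inv s) S" using S by (auto intro!: inj_onI)
  ultimately have "char_sum (chi k) (set_inv S) = (\<Sum>s\<in>S. chi k (inv s))"
    by (simp add: char_sum_def sum.reindex)
  also have "\<dots> = (\<Sum>s\<in>S. cnj (chi k s))" using S k by (intro sum.cong) (auto simp: chi_inv)
  finally show ?thesis by (simp add: char_sum_def)
qed

lemma mem_set_inv_iff:
  "S \<subseteq> carrier G \<Longrightarrow> x \<in> carrier G \<Longrightarrow> x \<in> set_inv S \<longleftrightarrow> inv x \<in> S"
  by (auto simp: SET_INV_def) (metis inv_inv)

text \<open>The transposed version, needed for the edges given by \<open>T\<close> as seen from part
  1; it follows by passing to the set of inverses, which conjugates the character sum.\<close>

lemma sum_chi_quotient':
  assumes S: "S \<subseteq> carrier G" and k: "k \<in> {1..n}" and g: "g \<in> carrier G"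
  shows "(\<Sum>h\<in>carrier G. (if g \<otimes> inv h \<in> S then 1 else 0) * chi k h) = cnj (char_sum (chi k) S) * chi k g"
proof -
  have "set_inv S \<subseteq> carrier G" using S by (auto simp: SET_INV_def)
  from sum_chi_quotient[OF this k g]
  have "(\<Sum>h\<in>carrier G. (if h \<otimes> inv g \<in> set_inv S then 1 else 0) * chi k h)
     = cnj (char_sum (chi k) S) * chi k g" by (simp add: char_sum_inv[OF S k])
  moreover have "(h \<otimes> inv g \<in> set_inv S) \<longleftrightarrow> (g \<otimes> inv h \<in> S)" if "h \<in> carrier G" for h
    using that g S by (simp add: mem_set_inv_iff inv_mult_group)
  ultimately show ?thesis by (simp cong: sum.cong)
qed

end

section \<open>Block diagonalisation of the adjacency matrix\<close>

text \<open>The matrix by which the adjacency matrix acts on the two copies of the character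
  \<open>c\<close>, one on each part. The conjugate in the lower left corner reflects that edges
  given by \<open>T\<close> are traversed backwards from part 1.\<close>

definition bicay_block :: "('a \<Rightarrow> complex) \<Rightarrow> 'a set \<Rightarrow> 'a set \<Rightarrow> 'a set \<Rightarrow> nat \<Rightarrow> nat \<Rightarrow> complex" where
  "bicay_block c R L T i j =
     (if i = j then (if i = 0 then char_sum c R else char_sum c L)
      else if i = 0 then char_sum c T else cnj (char_sum c T))"

locale bicay_graph = character_table +
  fixes R L T :: "'a set"
  assumes subsets: "R \<subseteq> carrier G" "L \<subseteq> carrier G" "T \<subseteq> carrier G"
    and inverse_closed: "R = set_inv R" "L = set_inv L"
begin

abbreviation "V \<equiv> carrier G \<times> {0, 1::nat}"
abbreviation "A \<equiv> adjacency (bicay G R L T)"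
abbreviation "B k \<equiv> bicay_block (chi k) R L T"

lemma inverse_closed_iff:
  assumes "g \<in> carrier G" "h \<in> carrier G"
  shows "g \<otimes> inv h \<in> R \<longleftrightarrow> h \<otimes> inv g \<in> R" "g \<otimes> inv h \<in> L \<longleftrightarrow> h \<otimes> inv g \<in> L"
  using mem_set_inv_iff[of R "g \<otimes> inv h"] mem_set_inv_iff[of L "g \<otimes> inv h"] assms subsets inverse_closed
  by (simp_all add: inv_mult_group)

text \<open>Within a part the orientation of an edge is immaterial, as \<open>R\<close> and
  \<open>L\<close> are closed under inversion. Between the parts \<open>T\<close> is always read
  from part 0 to part 1, so the last quotient is reversed.\<close>

lemma adjacency_bicay:
  assumes "g \<in> carrier G" "h \<in> carrier G"
  shows "A (g, 0) (h, 0) = (if h \<otimes> inv g \<in> R then 1 else 0)"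
    and "A (g, 1) (h, 1) = (if h \<otimes> inv g \<in> L then 1 else 0)"
    and "A (g, 0) (h, 1) = (if h \<otimes> inv g \<in> T then 1 else 0)"
    and "A (g, 1) (h, 0) = (if g \<otimes> inv h \<in> T then 1 else 0)"
  using assms inverse_closed_iff[OF assms]
  by (auto simp: adjacency_def bicay_def doubleton_eq_iff)

lemma real_char_sum_eq:
  assumes "k \<in> {1..n}"
  shows "char_sum (chi k) R = of_real (real_char_sum (chi k) R)"
    and "char_sum (chi k) L = of_real (real_char_sum (chi k) L)"
  using char_sum_inv[of R k] char_sum_inv[of L k] assms subsets inverse_closed
  by (auto simp: real_char_sum_def complex_eq_iff)

lemma adjacency_mult_chi:
  assumes k: "k \<in> {1..n}" and g: "g \<in> carrier G" and i: "i \<in> {0, 1}" and j: "j \<in> {0, 1}"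
  shows "(\<Sum>h\<in>carrier G. A (g, i) (h, j) * chi k h) = B k i j * chi k g"
  using i j sum_chi_quotient[OF subsets(1) k g] sum_chi_quotient[OF subsets(2) k g]
    sum_chi_quotient[OF subsets(3) k g] sum_chi_quotient'[OF subsets(3) k g]
  by (auto simp: bicay_block_def adjacency_bicay adjacency_bicay[unfolded One_nat_def] g cong: sum.cong)

lemma sum_vertices: "(\<Sum>v\<in>V. f v) = (\<Sum>j\<in>{0,1}. \<Sum>h\<in>carrier G. f (h, j))"
  unfolding sum.cartesian_product' by (rule sum.swap)

text \<open>Column orthogonality resolves the identity matrix, which is the case
  \<open>m = 0\<close>. Each further factor \<open>A\<close> acts on \<open>chi k\<close> through
  the block \<open>B k\<close>, so powers of \<open>A\<close> turn into powers of the
  blocks.\<close>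

lemma mat_power_bicay:
  assumes "g \<in> carrier G" "h \<in> carrier G" "i \<in> {0, 1}" "j \<in> {0, 1}"
  shows "mat_power V A m (g, i) (h, j) =
     (\<Sum>k=1..n. chi k g * cnj (chi k h) * mat_power {0, 1} (B k) m i j) / of_nat n"
  using assms(1,3)
proof (induction m arbitrary: g i)
  case 0
  have "(\<Sum>k=1..n. chi k g * cnj (chi k h) * (if i = j then 1 else 0))
     = (if i = j then (if g = h then of_nat n else 0) else 0)"
    using column_orthogonality[OF 0(1) assms(2)] by simp
  then show ?case using n_pos by simp
next
  case (Suc m)
  have "mat_power V A (Suc m) (g, i) (h, j)
     = (\<Sum>w\<in>{0,1}. \<Sum>x\<in>carrier G. A (g, i) (x, w) * mat_power V A m (x, w) (h, j))"
    by (simp only: mat_power.simps sum_vertices)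
  also have "\<dots> = (\<Sum>w\<in>{0,1}. \<Sum>x\<in>carrier G. \<Sum>k=1..n.
      (A (g, i) (x, w) * chi k x) * (cnj (chi k h) * mat_power {0, 1} (B k) m w j / of_nat n))"
    by (intro sum.cong refl)
       (simp add: Suc.IH sum_distrib_left sum_divide_distrib mult_ac del: insert_iff One_nat_def)
  also have "\<dots> = (\<Sum>w\<in>{0,1}. \<Sum>k=1..n. (\<Sum>x\<in>carrier G.
      A (g, i) (x, w) * chi k x) * (cnj (chi k h) * mat_power {0, 1} (B k) m w j / of_nat n))"
    by (subst sum.swap) (simp only: sum_distrib_right)
  also have "\<dots> = (\<Sum>w\<in>{0,1}. \<Sum>k=1..n.
      (B k i w * chi k g) * (cnj (chi k h) * mat_power {0, 1} (B k) m w j / of_nat n))"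
    by (intro sum.cong refl arg_cong2[where f="(*)"] adjacency_mult_chi Suc.prems)
  also have "\<dots> = (\<Sum>k=1..n. \<Sum>w\<in>{0,1}.
      (B k i w * chi k g) * (cnj (chi k h) * mat_power {0, 1} (B k) m w j / of_nat n))"
    by (rule sum.swap)
  also have "\<dots> = (\<Sum>k=1..n. chi k g * cnj (chi k h) * mat_power {0, 1} (B k) (Suc m) i j) / of_nat n"
    by (simp add: sum_divide_distrib sum_distrib_left algebra_simps add_divide_distrib)
  finally show ?case .
qed

end

section \<open>Powers and exponentials of Hermitian 2 x 2 matrices\<close>

text \<open>The sequences \<open>x\<close> and \<open>y\<close> form the first column of the powers
  of the Hermitian matrix with diagonal \<open>r\<close>, \<open>l\<close> and upper right entry
  \<open>c\<close>. Its eigenvalues are \<open>lm\<close> and \<open>lp\<close>, and the weights are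
  the upper left entries of the two spectral projections.\<close>

lemma two_by_two_power:
  fixes r l :: real and c :: complex and x y :: "nat \<Rightarrow> complex"
  defines "s \<equiv> sqrt ((r - l)\<^sup>2 + 4 * (cmod c)\<^sup>2)"
  defines "lm \<equiv> (r + l - s) / 2" and "lp \<equiv> (r + l + s) / 2"
  assumes c: "c \<noteq> 0"
    and x: "x 0 = 1" "\<And>m. x (Suc m) = of_real r * x m + c * y m"
    and y: "y 0 = 0" "\<And>m. y (Suc m) = cnj c * x m + of_real l * y m"
  shows "\<exists>a b::real. a > 0 \<and> b > 0 \<and> a + b = 1 \<and> (\<forall>m. x m = of_real (a * lm ^ m + b * lp ^ m))"
proof -
  have c2: "(cmod c)\<^sup>2 > 0" using c by simp
  have s2: "s\<^sup>2 = (r - l)\<^sup>2 + 4 * (cmod c)\<^sup>2" by (simp add: s_def)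
  \<comment> \<open>As \<open>c\<close> is nonzero this is strict, which puts \<open>r\<close>
    strictly between \<open>lm\<close> and \<open>lp\<close> and makes both weights
    positive.\<close>
  have s_gt: "\<bar>r - l\<bar> < s"
    unfolding s_def using c2 by (intro real_less_rsqrt) simp
  then have s0: "s > 0" by linarith
  have sum: "lm + lp = r + l" by (simp add: lm_def lp_def field_simps)
  have diff: "lp - lm = s" by (simp add: lm_def lp_def field_simps)
  have prod: "lm * lp = r * l - (cmod c)\<^sup>2"
  proof -
    have "lm * lp = ((r + l)\<^sup>2 - s\<^sup>2) / 4" by (simp add: lm_def lp_def power2_eq_square algebra_simps)
    then show ?thesis unfolding s2 by (simp add: power2_eq_square algebra_simps)
  qed
  define a b where "a = (lp - r) / s" and "b = (r - lm) / s"
  have "a > 0" "b > 0" using s_gt s0 by (auto simp: a_def b_def lm_def lp_def abs_if split: if_splits)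
  moreover have "a + b = 1" using diff s0 by (simp add: a_def b_def flip: add_divide_distrib)
  \<comment> \<open>The closed form of \<open>y\<close> is added to make the induction go
    through.\<close>
  moreover have "x m = of_real (a * lm ^ m + b * lp ^ m) \<and> y m = cnj c * of_real ((lp ^ m - lm ^ m) / s)" for m
  proof (induction m)
    case 0
    then show ?case using x(1) y(1) \<open>a + b = 1\<close> by simp
  next
    case (Suc m)
    have cc: "c * cnj c = of_real ((cmod c)\<^sup>2)" by (simp only: complex_norm_square)
    have sa: "s * a = lp - r" "s * b = r - lm" using s0 by (simp_all add: a_def b_def)
    \<comment> \<open>This and \<open>p2\<close> rearrange
      \<open>(lp - r) * (r - lm) = (cmod c)\<^sup>2\<close>, the characteristic equation evaluated
      at \<open>r\<close>.\<close>
    have p1: "(lp - r) * lm = r * (lp - r) - (cmod c)\<^sup>2"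
    proof -
      have "(lp - r) * lm = r * l - (cmod c)\<^sup>2 - r * lm" using prod by (simp add: algebra_simps)
      also have "l = lm + lp - r" using sum by simp
      finally show ?thesis by (simp add: algebra_simps)
    qed
    have p2: "(r - lm) * lp = r * (r - lm) + (cmod c)\<^sup>2"
    proof -
      have "(r - lm) * lp = r * lp - (r * l - (cmod c)\<^sup>2)" using prod by (simp add: algebra_simps)
      also have "l = lm + lp - r" using sum by simp
      finally show ?thesis by (simp add: algebra_simps)
    qed
    have "x (Suc m) = of_real (r * (a * lm ^ m + b * lp ^ m) + (cmod c)\<^sup>2 * ((lp ^ m - lm ^ m) / s))"
      unfolding x(2) using Suc.IH cc by (simp flip: mult.assoc)
    also have "r * (a * lm ^ m + b * lp ^ m) + (cmod c)\<^sup>2 * ((lp ^ m - lm ^ m) / s)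
       = ((r * (lp - r) - (cmod c)\<^sup>2) * lm ^ m + (r * (r - lm) + (cmod c)\<^sup>2) * lp ^ m) / s"
      using s0 by (simp add: a_def b_def field_simps)
    also have "\<dots> = a * lm ^ Suc m + b * lp ^ Suc m"
      unfolding p1[symmetric] p2[symmetric] using s0 by (simp add: a_def b_def field_simps)
    finally have X: "x (Suc m) = of_real (a * lm ^ Suc m + b * lp ^ Suc m)" .
    have "y (Suc m) = cnj c * of_real ((a * lm ^ m + b * lp ^ m) + l * ((lp ^ m - lm ^ m) / s))"
      unfolding y(2) using Suc.IH by (simp add: algebra_simps)
    also have "(a * lm ^ m + b * lp ^ m) + l * ((lp ^ m - lm ^ m) / s)
       = ((lp - (r + l)) * lm ^ m + (r + l - lm) * lp ^ m) / s"
      using s0 by (simp add: a_def b_def field_simps)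
    also have "\<dots> = (lp ^ Suc m - lm ^ Suc m) / s"
      unfolding sum[symmetric] by simp
    finally show ?case using X by blast
  qed
  ultimately show ?thesis by blast
qed

lemma mat_power_scale:
  "mat_power V (\<lambda>u v. c * A u v) m u v = c ^ m * mat_power V A m u v"
  by (induction m arbitrary: u) (simp_all add: sum_distrib_left mult_ac)

text \<open>For the adjacency matrix, this reality is what allows the characters in the entry
  formula to be replaced by their conjugates.\<close>

lemma mat_power_Reals:
  assumes "\<And>u v. A u v \<in> \<real>"
  shows "mat_power V A m u v \<in> \<real>"
  by (induction m arbitrary: u) (auto intro!: assms sum_in_Reals Reals_mult)

lemma sums_two_exponentials:
  fixes c :: complex
  shows "(\<lambda>m. c ^ m * of_real (a * u ^ m + b * v ^ m) / fact m)
     sums (of_real a * exp (c * of_real u) + of_real b * exp (c * of_real v))"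
proof -
  have "(\<lambda>m. of_real a * ((c * of_real u) ^ m /\<^sub>R fact m) + of_real b * ((c * of_real v) ^ m /\<^sub>R fact m))
     sums (of_real a * exp (c * of_real u) + of_real b * exp (c * of_real v))"
    by (intro sums_add sums_mult exp_converges)
  then show ?thesis
    by (simp add: scaleR_conv_of_real field_simps power_mult_distrib)
qed

section \<open>Eigenvalues of the graph, and perfect state transfer as equality of phases\<close>

context bicay_graph
begin

lemma block_power_convex:
  assumes k: "k \<in> {1..n}" and i: "i \<in> {0, 1}" and X: "X = (if i = 0 then R else L)"
    and u: "u = (if char_sum (chi k) T = 0 then real_char_sum (chi k) X else bicay_eig chi R L T (2 * k - 1))"
    and v: "v = (if char_sum (chi k) T = 0 then real_char_sum (chi k) X else bicay_eig chi R L T (2 * k))"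
  shows "\<exists>a b. a > 0 \<and> b > 0 \<and> a + b = 1 \<and>
     (\<forall>m. mat_power {0, 1} (B k) m i i = of_real (a * u ^ m + b * v ^ m))"
proof (cases "char_sum (chi k) T = 0")
  case True
  have "mat_power {0, 1} (B k) m i i = of_real (real_char_sum (chi k) X ^ m)" for m
  proof (induction m)
    case (Suc m)
    then show ?case using i True real_char_sum_eq[OF k]
      by (auto simp: bicay_block_def X)
  qed simp
  \<comment> \<open>Here \<open>u = v\<close>, so the weights are arbitrary; two equal ones let
    diagonal blocks share the format of the others.\<close>
  then show ?thesis using True u v by (intro exI[of _ "1/2"]) simp
next
  case False
  define r where "r = real_char_sum (chi k) R"
  define l where "l = real_char_sum (chi k) L"
  define c where "c = char_sum (chi k) T"
  have k1: "k \<ge> 1" using k by simp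
  have uv: "u = (r + l - sqrt ((r - l)\<^sup>2 + 4 * (cmod c)\<^sup>2)) / 2"
       "v = (r + l + sqrt ((r - l)\<^sup>2 + 4 * (cmod c)\<^sup>2)) / 2"
    using False k1 unfolding u v by (simp_all add: bicay_eig_def r_def l_def c_def Let_def)
  note rl = real_char_sum_eq[OF k, folded r_def l_def]
  show ?thesis
  proof (cases "i = 0")
    case True
    show ?thesis unfolding uv
      by (rule two_by_two_power[where c = c and y = "\<lambda>m. mat_power {0, 1} (B k) m 1 i"])
         (use True False rl in \<open>auto simp: bicay_block_def c_def[symmetric]\<close>)
  next
    case i1: False
    then have i1: "i = 1" using i by simp
    \<comment> \<open>The lower diagonal entry is the upper one of the matrix with its two
      coordinates exchanged: \<open>r\<close> and \<open>l\<close> swap and \<open>c\<close> is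
      conjugated, while the eigenvalues stay the same.\<close>
    have uv': "u = (l + r - sqrt ((l - r)\<^sup>2 + 4 * (cmod (cnj c))\<^sup>2)) / 2"
       "v = (l + r + sqrt ((l - r)\<^sup>2 + 4 * (cmod (cnj c))\<^sup>2)) / 2"
      unfolding uv by (simp_all add: power2_commute add.commute)
    show ?thesis unfolding uv'
      by (rule two_by_two_power[where c = "cnj c" and y = "\<lambda>m. mat_power {0, 1} (B k) m 0 i"])
         (use i1 False rl in \<open>auto simp: bicay_block_def c_def[symmetric]\<close>)
  qed
qed

text \<open>An eigenvector of a block, multiplied by \<open>chi k\<close>, is an eigenvector of the
  whole matrix; it does not vanish because \<open>chi k\<close> is 1 at the identity.\<close>

lemma mat_eigenvalue_bicay:
  assumes k: "k \<in> {1..n}" and nz: "x \<noteq> 0 \<or> y \<noteq> 0"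
    and eig: "B k 0 0 * x + B k 0 1 * y = \<theta> * x" "B k 1 0 * x + B k 1 1 * y = \<theta> * y"
  shows "mat_eigenvalue V A \<theta>"
  unfolding mat_eigenvalue_def
proof (intro exI conjI ballI)
  let ?f = "\<lambda>(g, i::nat). chi k g * (if i = 0 then x else y)"
  show "\<exists>u\<in>V. ?f u \<noteq> 0"
    using nz chi_one[OF k] by (cases "x = 0") (auto intro!: bexI[of _ \<one>])
  fix u assume "u \<in> V"
  then obtain g i where u: "u = (g, i)" and g: "g \<in> carrier G" and i: "i \<in> {0, 1}" by blast
  have "(\<Sum>v\<in>V. A u v * ?f v) =
      (\<Sum>j\<in>{0,1}. (\<Sum>h\<in>carrier G. A (g, i) (h, j) * chi k h) * (if j = 0 then x else y))"
    by (simp only: sum_vertices u sum_distrib_right) (simp add: mult.assoc)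
  also have "\<dots> = (\<Sum>j\<in>{0,1}. B k i j * chi k g * (if j = 0 then x else y))"
    by (intro sum.cong refl arg_cong2[where f="(*)"] adjacency_mult_chi k g i)
  also have "\<dots> = chi k g * (B k i 0 * x + B k i 1 * y)" by (simp add: algebra_simps)
  also have "\<dots> = \<theta> * ?f u" using i eig u by auto
  finally show "(\<Sum>v\<in>V. A u v * ?f v) = \<theta> * ?f u" .
qed

lemma bicay_eigenvalues_Ints:
  assumes int: "integral_graph (bicay G R L T)" and k: "k \<in> {1..n}"
  shows "char_sum (chi k) T = 0 \<Longrightarrow> real_char_sum (chi k) R \<in> \<int> \<and> real_char_sum (chi k) L \<in> \<int>"
    and "char_sum (chi k) T \<noteq> 0 \<Longrightarrow>
      bicay_eig chi R L T (2 * k - 1) \<in> \<int> \<and> bicay_eig chi R L T (2 * k) \<in> \<int>"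
proof -
  have int': "x \<in> \<int>" if "mat_eigenvalue V A (of_real x)" for x :: real
  proof -
    have "complex_of_real x \<in> \<int>" using int that by (auto simp: integral_graph_def bicay_def)
    then obtain z where "complex_of_real x = of_int z" by (elim Ints_cases)
    then have "x = of_int z" by (metis of_real_eq_iff of_real_of_int_eq)
    then show ?thesis by simp
  qed
  note rl = real_char_sum_eq[OF k]
  {
    assume "char_sum (chi k) T = 0"
    then show "real_char_sum (chi k) R \<in> \<int> \<and> real_char_sum (chi k) L \<in> \<int>"
      using mat_eigenvalue_bicay[OF k, of 1 0 "of_real (real_char_sum (chi k) R)"]
        mat_eigenvalue_bicay[OF k, of 0 1 "of_real (real_char_sum (chi k) L)"] rl
      by (auto intro!: int' simp: bicay_block_def)
  next
    assume T: "char_sum (chi k) T \<noteq> 0"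
    define r where "r = real_char_sum (chi k) R"
    define l where "l = real_char_sum (chi k) L"
    define c where "c = char_sum (chi k) T"
    define s where "s = sqrt ((r - l)\<^sup>2 + 4 * (cmod c)\<^sup>2)"
    have s2: "s\<^sup>2 = (r - l)\<^sup>2 + 4 * (cmod c)\<^sup>2" by (simp add: s_def)
    \<comment> \<open>The equation on \<open>x\<close> is the characteristic equation of the block,
      and \<open>(c, x - r)\<close> is then an eigenvector, nonzero because \<open>c\<close>
      is.\<close>
    have root: "x \<in> \<int>" if x: "(x - r) * (x - l) = (cmod c)\<^sup>2" for x
    proof (rule int', rule mat_eigenvalue_bicay[OF k, of c "of_real (x - r)"])
      show "c \<noteq> 0 \<or> complex_of_real (x - r) \<noteq> 0" using T by (simp add: c_def)
      show "B k 0 0 * c + B k 0 1 * of_real (x - r) = of_real x * c"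
        using rl by (simp add: bicay_block_def r_def c_def algebra_simps)
      have "cnj c * c = of_real ((x - r) * (x - l))"
        unfolding x by (simp only: complex_norm_square mult.commute)
      then show "B k 1 0 * c + B k 1 1 * of_real (x - r) = of_real x * of_real (x - r)"
        using rl by (simp add: bicay_block_def l_def c_def[symmetric] algebra_simps)
    qed
    have "((r + l - s) / 2 - r) * ((r + l - s) / 2 - l) = (s\<^sup>2 - (r - l)\<^sup>2) / 4"
      "((r + l + s) / 2 - r) * ((r + l + s) / 2 - l) = (s\<^sup>2 - (r - l)\<^sup>2) / 4"
      by (simp_all add: power2_eq_square field_simps)
    then have "(r + l - s) / 2 \<in> \<int>" "(r + l + s) / 2 \<in> \<int>"
      using s2 by (auto intro!: root)
    then show "bicay_eig chi R L T (2 * k - 1) \<in> \<int> \<and> bicay_eig chi R L T (2 * k) \<in> \<int>"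
      using k by (simp add: bicay_eig_def Let_def r_def l_def c_def s_def)
  }
qed

lemma perfect_state_transfer_iff:
  assumes p: "p \<in> carrier G" and q: "q \<in> carrier G" and i: "i \<in> {0, 1}"
    and X: "X = (if i = 0 then R else L)"
    and u: "\<And>k. u k = (if char_sum (chi k) T = 0 then real_char_sum (chi k) X else bicay_eig chi R L T (2 * k - 1))"
    and v: "\<And>k. v k = (if char_sum (chi k) T = 0 then real_char_sum (chi k) X else bicay_eig chi R L T (2 * k))"
    and principal: "\<forall>g\<in>carrier G. chi 1 g = 1"
  shows "perfect_state_transfer (bicay G R L T) (p, i) (q, i) t \<longleftrightarrow>
    (\<forall>k\<in>{1..n}. chi k (p \<otimes> inv q) \<in> {1, -1} \<and> cis (- (t * u k)) = cis (- (t * v k)) \<and>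
       chi k (p \<otimes> inv q) * cis (- (t * u k)) = cis (- (t * u 1)))"
proof -
  define g where "g = p \<otimes> inv q"
  have g: "g \<in> carrier G" using p q by (simp add: g_def)
  have chi_g: "chi k p * cnj (chi k q) = chi k g" if "k \<in> {1..n}" for k
    using that p q by (simp add: g_def chi_mult chi_inv)
  have "\<forall>k\<in>{1..n}. \<exists>a b. a > 0 \<and> b > 0 \<and> a + b = 1 \<and>
     (\<forall>m. mat_power {0, 1} (B k) m i i = of_real (a * u k ^ m + b * v k ^ m))"
    \<comment> \<open>The weights are the same for all powers \<open>m\<close>, so the exponential
      series can be summed with them fixed.\<close>
    using block_power_convex[OF _ i X u v] by blast
  then obtain a b where ab: "\<And>k. k \<in> {1..n} \<Longrightarrow> a k > 0" "\<And>k. k \<in> {1..n} \<Longrightarrow> b k > 0"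
      "\<And>k. k \<in> {1..n} \<Longrightarrow> a k + b k = 1"
    and pow: "\<And>k m. k \<in> {1..n} \<Longrightarrow> mat_power {0, 1} (B k) m i i = of_real (a k * u k ^ m + b k * v k ^ m)"
    by metis
  define c where "c = - \<i> * complex_of_real t"
  have cis: "exp (c * of_real x) = cis (- (t * x))" for x
    by (simp add: c_def cis_conv_exp mult_ac)
  let ?f = "\<lambda>k. of_real (a k) * cis (- (t * u k)) + of_real (b k) * cis (- (t * v k))"
  define P where "P = (\<lambda>m. mat_power V A m (p, i) (q, i))"
  have P1: "P m = (\<Sum>k=1..n. chi k g * of_real (a k * u k ^ m + b k * v k ^ m)) / of_nat n" for m
    unfolding P_def mat_power_bicay[OF p q i i]
    by (intro arg_cong2[where f="(/)"] sum.cong refl) (simp only: chi_g pow)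
  have "P m \<in> \<real>" for m unfolding P_def by (rule mat_power_Reals) (simp add: adjacency_def)
  then have "P m = cnj (P m)" for m by (simp add: Reals_cnj_iff)
  moreover have "cnj (P m) = (\<Sum>k=1..n. cnj (chi k g) * of_real (a k * u k ^ m + b k * v k ^ m)) / of_nat n" for m
    unfolding P1 by simp
  ultimately have P2: "P m = (\<Sum>k=1..n. cnj (chi k g) * of_real (a k * u k ^ m + b k * v k ^ m)) / of_nat n" for m
    by metis
  \<comment> \<open>The coefficients \<open>w\<close> are left free so that one computation serves
    both the characters and their conjugates.\<close>
  have series: "(\<lambda>m. c ^ m * ((\<Sum>k=1..n. w k * of_real (a k * u k ^ m + b k * v k ^ m)) / of_nat n) / fact m)
      sums ((\<Sum>k=1..n. w k * ?f k) / of_nat n)" for w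
  proof -
    have "(\<lambda>m. (\<Sum>k=1..n. w k * (c ^ m * of_real (a k * u k ^ m + b k * v k ^ m) / fact m)) / of_nat n)
      sums ((\<Sum>k=1..n. w k * ?f k) / of_nat n)"
      unfolding cis[symmetric] by (intro sums_divide sums_sum sums_mult sums_two_exponentials)
    moreover have "(\<Sum>k=1..n. w k * (c ^ m * of_real (a k * u k ^ m + b k * v k ^ m) / fact m)) / of_nat n
      = c ^ m * ((\<Sum>k=1..n. w k * of_real (a k * u k ^ m + b k * v k ^ m)) / of_nat n) / fact m" for m
      by (simp add: sum_distrib_left sum_divide_distrib mult_ac)
    ultimately show ?thesis by simp
  qed
  have s1: "(\<lambda>m. c ^ m * P m / fact m) sums ((\<Sum>k=1..n. chi k g * ?f k) / of_nat n)"
    unfolding P1 by (rule series)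
  have s2: "(\<lambda>m. c ^ m * P m / fact m) sums ((\<Sum>k=1..n. cnj (chi k g) * ?f k) / of_nat n)"
    unfolding P2 by (rule series)
  \<comment> \<open>Both sums are limits of the same series, hence equal.\<close>
  have sym: "(\<Sum>k=1..n. chi k g * ?f k) = (\<Sum>k=1..n. cnj (chi k g) * ?f k)"
    using sums_unique2[OF s1 s2] n_pos by simp
  have "transfer_matrix (bicay G R L T) t (p, i) (q, i) = (\<Sum>m. c ^ m * P m / fact m)"
    by (simp add: transfer_matrix_def mat_exp_def P_def bicay_def c_def flip: mat_power_scale)
  also have "\<dots> = (\<Sum>k=1..n. chi k g * ?f k) / of_nat n" using sums_unique[OF s1] by simp
  finally have "perfect_state_transfer (bicay G R L T) (p, i) (q, i) t \<longleftrightarrow>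
      cmod (\<Sum>k=1..n. chi k g * ?f k) = real (card {1..n})"
    using n_pos by (auto simp: perfect_state_transfer_def norm_divide)
  also have "\<dots> \<longleftrightarrow> (\<forall>k\<in>{1..n}. chi k g \<in> {1, -1} \<and> cis (- (t * u k)) = cis (- (t * v k)) \<and>
       chi k g * cis (- (t * u k)) = cis (- (t * u 1)))"
    by (rule cmod_sum_convex_phases_iff)
       (use ab sym g principal n_pos in \<open>auto simp: cmod_chi\<close>)
  finally show ?thesis by (simp add: g_def)
qed

end

section \<open>From phases to the gcd and valuation conditions\<close>

lemma real_gcd_eq_Gcd_image:
  assumes "\<And>k. k \<in> K \<Longrightarrow> f k = of_int (F k)"
  shows "real_gcd {f k | k. k \<in> K} = Gcd (F ` K)"
proof -
  have "{m::int. of_int m \<in> {f k | k. k \<in> K}} = F ` K" using assms by (force simp: image_iff)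
  then show ?thesis by (simp add: real_gcd_def)
qed

lemma cis_minus_eq_iff: "c * cis (- x) = cis (- y) \<longleftrightarrow> cis (y - x) * c = 1"
proof -
  have "cis (y - x) * c = cis y * (c * cis (- x))"
    using cis_mult[of y "- x"] by (simp add: mult_ac)
  moreover have "cis y * z = 1 \<longleftrightarrow> z = cis (- y)" for z
    by (metis add.right_inverse cis_mult cis_neq_zero cis_zero mult_left_cancel)
  ultimately show ?thesis by metis
qed

theorem theorem4p11:
  fixes G :: "('a, 'm) monoid_scheme"
    and chi :: "nat \<Rightarrow> 'a \<Rightarrow> complex"
    and R L T X :: "'a set"
    and \<Gamma> :: "('a \<times> nat) ugraph"
    and lam :: "nat \<Rightarrow> real"
    and H :: "nat set"
    and \<Omega> :: "int \<Rightarrow> nat set"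
    and M\<^sub>0 M\<^sub>1 M\<^sub>X M\<^sub>E :: int
    and n i :: nat
    and p q :: 'a
    and t :: real
  assumes G: "comm_group G" "finite (carrier G)" "order G = n"
    and characters: "\<forall>k\<in>{1..n}. group_character G (chi k)"
    and distinct: "\<forall>k\<in>{1..n}. \<forall>l\<in>{1..n}. k \<noteq> l \<longrightarrow> (\<exists>g\<in>carrier G. chi k g \<noteq> chi l g)"
    and principal: "\<forall>g\<in>carrier G. chi 1 g = 1"
    and subsets: "R \<subseteq> carrier G" "L \<subseteq> carrier G" "T \<subseteq> carrier G"
    and inverse_closed: "R = set_inv\<^bsub>G\<^esub> R" "L = set_inv\<^bsub>G\<^esub> L"
    and no_identity: "\<one>\<^bsub>G\<^esub> \<notin> R \<union> L"
    and \<Gamma>: "\<Gamma> = bicay G R L T"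
    and integral: "integral_graph \<Gamma>"
    and lam: "lam = bicay_eig chi R L T"
    and H: "H = {k\<in>{1..n}. char_sum (chi k) T = 0}"
    and M\<^sub>0: "M\<^sub>0 = real_gcd {lam (2 * k) - lam (2 * k - 1) | k. k \<in> {1..n} - H}"
    and M\<^sub>1: "M\<^sub>1 = real_gcd {lam 2 - lam (2 * k - 1) | k. k \<in> {1..n} - H}"
    and i: "i \<in> {0, 1}"
    and pq: "p \<in> carrier G" "q \<in> carrier G"
    and X: "X = (if i = 0 then R else L)"
    and \<Omega>: "\<And>j. \<Omega> j = {k\<in>{1..n}. chi k (p \<otimes>\<^bsub>G\<^esub> inv\<^bsub>G\<^esub> q) = of_int j}"
    and M\<^sub>E: "M\<^sub>E = real_gcd {real (card X) - real_char_sum (chi k) X | k. k \<in> {1..n}}"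
    and M\<^sub>X: "M\<^sub>X = (if H \<noteq> {} then real_gcd {lam 2 - real_char_sum (chi k) X | k. k \<in> H} else 0)"
  shows "perfect_state_transfer \<Gamma> (p, i) (q, i) t \<longleftrightarrow>
      (\<forall>k\<in>{1..n}. chi k (p \<otimes>\<^bsub>G\<^esub> inv\<^bsub>G\<^esub> q) \<in> {1, -1})
    \<and> (\<exists>\<mu>::int.
          (\<forall>k\<in>\<Omega> (-1) - H. v2 (lam 2 - lam (2 * k - 1)) = ereal (of_int \<mu>))
        \<and> (T \<noteq> {} \<longrightarrow> (\<forall>k\<in>\<Omega> (-1) \<inter> H. v2 (lam 2 - real_char_sum (chi k) X) = ereal (of_int \<mu>)))
        \<and> (T = {} \<longrightarrow> (\<forall>k\<in>\<Omega> (-1). v2 (real (card X) - real_char_sum (chi k) X) = ereal (of_int \<mu>)))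
        \<and> (\<forall>k\<in>{1..n} - H. v2 (lam (2 * k) - lam (2 * k - 1)) \<ge> ereal (of_int (\<mu> + 1)))
        \<and> (\<forall>k\<in>\<Omega> 1 - H. v2 (lam 2 - lam (2 * k - 1)) \<ge> ereal (of_int (\<mu> + 1)))
        \<and> (T \<noteq> {} \<longrightarrow> (\<forall>k\<in>\<Omega> 1 \<inter> H. v2 (lam 2 - real_char_sum (chi k) X) \<ge> ereal (of_int (\<mu> + 1))))
        \<and> (T = {} \<longrightarrow> (\<forall>k\<in>\<Omega> 1. v2 (real (card X) - real_char_sum (chi k) X) \<ge> ereal (of_int (\<mu> + 1)))))
    \<and> (T \<noteq> {} \<longrightarrow>
          (\<Omega> (-1) \<noteq> {} \<longrightarrow> t \<in> odd_times (gcd M\<^sub>0 (gcd M\<^sub>1 M\<^sub>X)))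
        \<and> (\<Omega> (-1) = {} \<longrightarrow> t \<in> even_times (gcd M\<^sub>0 (gcd M\<^sub>1 M\<^sub>X))))
    \<and> (T = {} \<longrightarrow>
          (if \<Omega> (-1) = {} \<or> (\<forall>k\<in>\<Omega> (-1). char_sum (chi k) X = of_nat (card X))
           then t \<in> even_times M\<^sub>E else t \<in> odd_times M\<^sub>E))"
proof -
  interpret comm_group G by (rule G(1))
  interpret bicay_graph G chi n R L T
    by unfold_locales (use G characters distinct subsets inverse_closed in auto)
  define g where "g = p \<otimes>\<^bsub>G\<^esub> inv\<^bsub>G\<^esub> q"
  define u where "u = (\<lambda>k. if char_sum (chi k) T = 0 then real_char_sum (chi k) X else lam (2 * k - 1))"
  define v where "v = (\<lambda>k. if char_sum (chi k) T = 0 then real_char_sum (chi k) X else lam (2 * k))"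
  have one: "1 \<in> {1..n}" using n_pos by simp
  have "\<forall>k\<in>{1..n}. u k \<in> \<int> \<and> v k \<in> \<int>"
    using bicay_eigenvalues_Ints[OF integral[unfolded \<Gamma>]] by (auto simp: u_def v_def X lam)
  then have "\<forall>k\<in>{1..n}. \<exists>a b::int. u k = of_int a \<and> v k = of_int b" by (metis Ints_cases)
  then obtain U V :: "nat \<Rightarrow> int" where UV: "\<And>k. k \<in> {1..n} \<Longrightarrow> u k = of_int (U k)"
      "\<And>k. k \<in> {1..n} \<Longrightarrow> v k = of_int (V k)" by metis
  \<comment> \<open>\<open>d k\<close> measures block \<open>k\<close> against the reference value
    \<open>v 1\<close> of the principal block, and \<open>e k\<close> is the gap within block
    \<open>k\<close>.\<close>
  define d where "d = (\<lambda>k. V 1 - U k)"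
  define e where "e = (\<lambda>k. V k - U k)"
  have e_H: "e k = 0" if "k \<in> H" for k
  proof -
    have "u k = v k" using that by (simp add: u_def v_def H)
    then show ?thesis using UV[of k] that by (simp add: e_def H)
  qed
  have e_nH: "lam (2 * k) - lam (2 * k - 1) = of_int (e k)" if "k \<in> {1..n} - H" for k
    using that UV[of k] by (simp add: e_def H u_def v_def)
  have XG: "X \<subseteq> carrier G" using X subsets by auto
  have one_X: "real_char_sum (chi 1) X = real (card X)" using principal XG
    by (simp add: real_char_sum_def char_sum_def subset_eq)
  have one_T: "char_sum (chi 1) T = of_nat (card T)" using principal subsets(3)
    by (simp add: char_sum_def subset_eq)
  have fT: "finite T" using subsets fin by (auto intro: finite_subset)
  \<comment> \<open>The two cases of the theorem separate here: the principal character sum over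
    \<open>T\<close> is its cardinality and vanishes only for empty \<open>T\<close>.\<close>
  have v1: "v 1 = (if T = {} then real (card X) else lam 2)"
    using one_T one_X fT by (auto simp: v_def)
  have dT: "lam 2 - lam (2 * k - 1) = of_int (d k)" if "T \<noteq> {}" "k \<in> {1..n} - H" for k
    using that v1 UV(2)[OF one] UV(1)[of k] by (simp add: d_def H u_def)
  have dX: "lam 2 - real_char_sum (chi k) X = of_int (d k)" if "T \<noteq> {}" "k \<in> H" for k
    using that v1 UV(2)[OF one] UV(1)[of k] by (simp add: d_def H u_def)
  have dE: "real (card X) - real_char_sum (chi k) X = of_int (d k)" if "T = {}" "k \<in> {1..n}" for k
    using that v1 UV(2)[OF one] UV(1)[of k] by (simp add: d_def u_def char_sum_def)
  have H_all: "H = {1..n}" if "T = {}" using that by (auto simp: H char_sum_def)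
  have H_sub: "H \<subseteq> {1..n}" by (auto simp: H)
  have \<Omega>_sub: "\<Omega> j \<subseteq> {1..n}" for j by (auto simp: \<Omega>)
  let ?c1 = "\<forall>k\<in>{1..n}. chi k g \<in> {1, -1}"
  \<comment> \<open>The integers whose product with \<open>t\<close> must be an even multiple of pi;
    \<open>B'\<close> holds those needing an odd one. Gaps of blocks in \<open>H\<close> are 0 and
    impose nothing.\<close>
  define A' where "A' = e ` ({1..n} - H) \<union> d ` \<Omega> 1"
  define B' where "B' = d ` \<Omega> (-1)"
  have cis_e: "cis (- (t * u k)) = cis (- (t * v k)) \<longleftrightarrow> (\<exists>z::int. t * of_int (e k) = 2 * pi * of_int z)"
    if "k \<in> {1..n}" for k
    unfolding cis_eq_one_iff[symmetric] using cis_minus_eq_iff[of 1 "t * u k" "t * v k"] UV that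
    by (simp add: e_def algebra_simps)
  have cis_d: "cis (- (t * u k)) = cis (- (t * v 1)) \<longleftrightarrow> (\<exists>z::int. t * of_int (d k) = 2 * pi * of_int z)"
    "- cis (- (t * u k)) = cis (- (t * v 1)) \<longleftrightarrow> (\<exists>z::int. t * of_int (d k) = (1 + 2 * of_int z) * pi)"
    if "k \<in> {1..n}" for k
    unfolding cis_eq_one_iff[symmetric] cis_eq_minus_one_iff[symmetric]
    using cis_minus_eq_iff[of 1 "t * u k" "t * v 1"] cis_minus_eq_iff[of "-1" "t * u k" "t * v 1"]
      UV(1)[OF that] UV(2)[OF one]
    by (simp_all add: d_def right_diff_distrib minus_equation_iff[of _ 1] eq_commute[of "-1"])
  have "perfect_state_transfer \<Gamma> (p, i) (q, i) t \<longleftrightarrow>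
    (\<forall>k\<in>{1..n}. chi k g \<in> {1, -1} \<and> cis (- (t * u k)) = cis (- (t * v k)) \<and>
       chi k g * cis (- (t * u k)) = cis (- (t * u 1)))"
    unfolding \<Gamma> g_def
    by (rule perfect_state_transfer_iff[OF pq i X _ _ principal]) (simp_all add: u_def v_def lam)
  \<comment> \<open>The instance \<open>k = 1\<close> equates the phases of \<open>u 1\<close> and
    \<open>v 1\<close>, so the reference value may be switched to \<open>v 1\<close>.\<close>
  also have "\<dots> \<longleftrightarrow> (\<forall>k\<in>{1..n}. chi k g \<in> {1, -1} \<and> cis (- (t * u k)) = cis (- (t * v k)) \<and>
       chi k g * cis (- (t * u k)) = cis (- (t * v 1)))"
    using one by (metis (no_types, lifting))
  also have "\<dots> \<longleftrightarrow> ?c1 \<and>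
      ((\<forall>a\<in>A'. \<exists>z::int. t * of_int a = 2 * pi * of_int z) \<and>
       (\<forall>b\<in>B'. \<exists>z::int. t * of_int b = (1 + 2 * of_int z) * pi))" (is "?l \<longleftrightarrow> ?r")
  proof
    assume l: ?l
    have "\<exists>z::int. t * of_int a = 2 * pi * of_int z" if "a \<in> A'" for a
    proof -
      from that consider k where "k \<in> {1..n}" "a = e k" | k where "k \<in> {1..n}" "chi k g = 1" "a = d k"
        by (auto simp: A'_def \<Omega> g_def)
      then show ?thesis
      proof cases
        case 1
        then show ?thesis using l cis_e by blast
      next
        case 2
        then show ?thesis using l cis_d(1)[of k] by (metis mult_1)
      qed
    qed
    moreover have "\<exists>z::int. t * of_int b = (1 + 2 * of_int z) * pi" if "b \<in> B'" for b
    proof -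
      from that obtain k where "k \<in> {1..n}" "chi k g = -1" "b = d k"
        by (auto simp: B'_def \<Omega> g_def)
      then show ?thesis using l cis_d(2)[of k] by (metis mult_minus1)
    qed
    ultimately show ?r using l by blast
  next
    assume r: ?r
    show ?l
    proof
      fix k assume k: "k \<in> {1..n}"
      have "\<exists>z::int. t * of_int (e k) = 2 * pi * of_int z"
      proof (cases "k \<in> H")
        case True
        then show ?thesis using e_H by (auto intro: exI[of _ 0])
      next
        case False
        then have "e k \<in> A'" using k by (auto simp: A'_def)
        then show ?thesis using r by blast
      qed
      then have 1: "cis (- (t * u k)) = cis (- (t * v k))" using cis_e[OF k] by blast
      have w: "chi k g = 1 \<or> chi k g = -1" using r k by auto
      then have "chi k g * cis (- (t * u k)) = cis (- (t * v 1))"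
      proof
        assume w: "chi k g = 1"
        then have "d k \<in> A'" using k by (auto simp: A'_def \<Omega> g_def)
        then show ?thesis using r cis_d(1)[OF k] w by auto
      next
        assume w: "chi k g = -1"
        then have "d k \<in> B'" using k by (auto simp: B'_def \<Omega> g_def)
        then show ?thesis using r cis_d(2)[OF k] w by auto
      qed
      with 1 w show "chi k g \<in> {1, -1} \<and> cis (- (t * u k)) = cis (- (t * v k)) \<and>
        chi k g * cis (- (t * u k)) = cis (- (t * v 1))" by blast
    qed
  qed
  also have "\<dots> \<longleftrightarrow> ?c1 \<and> ((\<exists>\<mu>::int. (\<forall>b\<in>B'. v2 (of_int b) = ereal (of_int \<mu>)) \<and>
                   (\<forall>a\<in>A'. v2 (of_int a) \<ge> ereal (of_int (\<mu> + 1)))) \<and>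
         t \<in> (if B' = {} then even_times (Gcd (A' \<union> B')) else odd_times (Gcd (A' \<union> B'))))"
    by (subst even_odd_multiples_of_pi_iff) (auto simp: A'_def B'_def intro: finite_subset[OF H_sub] finite_subset[OF \<Omega>_sub])
  finally have main: "perfect_state_transfer \<Gamma> (p, i) (q, i) t \<longleftrightarrow>
      ?c1 \<and> ((\<exists>\<mu>::int. (\<forall>b\<in>B'. v2 (of_int b) = ereal (of_int \<mu>)) \<and>
                   (\<forall>a\<in>A'. v2 (of_int a) \<ge> ereal (of_int (\<mu> + 1)))) \<and>
         t \<in> (if B' = {} then even_times (Gcd (A' \<union> B')) else odd_times (Gcd (A' \<union> B'))))" .
  have B'_empty: "B' = {} \<longleftrightarrow> \<Omega> (-1) = {}" by (simp add: B'_def)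
  \<comment> \<open>Once all character values are 1 or -1, the sets \<open>\<Omega> 1\<close> and
    \<open>\<Omega> (-1)\<close> exhaust the indices and the gcd no longer depends on them.\<close>
  have AB: "A' \<union> B' = e ` ({1..n} - H) \<union> d ` {1..n}" if ?c1
  proof -
    have "\<Omega> 1 \<union> \<Omega> (-1) = {1..n}" using that by (auto simp: \<Omega> g_def)
    then show ?thesis unfolding A'_def B'_def by blast
  qed
  show ?thesis
  proof (cases "T = {}")
    case False
    have M01: "M\<^sub>0 = Gcd (e ` ({1..n} - H))" "M\<^sub>1 = Gcd (d ` ({1..n} - H))"
      unfolding M\<^sub>0 M\<^sub>1 using e_nH dT[OF False] by (intro real_gcd_eq_Gcd_image; blast)+
    \<comment> \<open>For empty \<open>H\<close> the gcd of the empty set is 0, in line with the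
      convention for \<open>M\<^sub>X\<close>.\<close>
    have MX: "M\<^sub>X = Gcd (d ` H)"
      unfolding M\<^sub>X using real_gcd_eq_Gcd_image[of H, OF dX[OF False]] by simp
    have split: "d ` {1..n} = d ` ({1..n} - H) \<union> d ` H" using H_sub by blast
    have gcd: "Gcd (A' \<union> B') = gcd M\<^sub>0 (gcd M\<^sub>1 M\<^sub>X)" if ?c1
      unfolding AB[OF that] split Gcd_union_int M01 MX by (rule refl)
    have v2: "(\<forall>b\<in>B'. v2 (of_int b) = ereal (of_int \<mu>)) \<and> (\<forall>a\<in>A'. v2 (of_int a) \<ge> ereal (of_int (\<mu> + 1)))
     \<longleftrightarrow> (\<forall>k\<in>\<Omega> (-1) - H. v2 (lam 2 - lam (2 * k - 1)) = ereal (of_int \<mu>))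
        \<and> (\<forall>k\<in>\<Omega> (-1) \<inter> H. v2 (lam 2 - real_char_sum (chi k) X) = ereal (of_int \<mu>))
        \<and> (\<forall>k\<in>{1..n} - H. v2 (lam (2 * k) - lam (2 * k - 1)) \<ge> ereal (of_int (\<mu> + 1)))
        \<and> (\<forall>k\<in>\<Omega> 1 - H. v2 (lam 2 - lam (2 * k - 1)) \<ge> ereal (of_int (\<mu> + 1)))
        \<and> (\<forall>k\<in>\<Omega> 1 \<inter> H. v2 (lam 2 - real_char_sum (chi k) X) \<ge> ereal (of_int (\<mu> + 1)))" for \<mu> :: int
    proof -
      have 1: "(\<forall>k\<in>\<Omega> j. Q (of_int (d k))) \<longleftrightarrow>
         (\<forall>k\<in>\<Omega> j - H. Q (lam 2 - lam (2 * k - 1))) \<and> (\<forall>k\<in>\<Omega> j \<inter> H. Q (lam 2 - real_char_sum (chi k) X))"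
        for Q :: "real \<Rightarrow> bool" and j
      proof -
        have "(\<forall>k\<in>\<Omega> j. Q (of_int (d k))) \<longleftrightarrow>
            (\<forall>k\<in>\<Omega> j - H. Q (of_int (d k))) \<and> (\<forall>k\<in>\<Omega> j \<inter> H. Q (of_int (d k)))" by blast
        also have "(\<forall>k\<in>\<Omega> j - H. Q (of_int (d k))) \<longleftrightarrow> (\<forall>k\<in>\<Omega> j - H. Q (lam 2 - lam (2 * k - 1)))"
          by (intro ball_cong refl arg_cong[where f = Q] dT[OF False, symmetric]) (use \<Omega>_sub in blast)
        also have "(\<forall>k\<in>\<Omega> j \<inter> H. Q (of_int (d k))) \<longleftrightarrow> (\<forall>k\<in>\<Omega> j \<inter> H. Q (lam 2 - real_char_sum (chi k) X))"
          by (intro ball_cong refl arg_cong[where f = Q] dX[OF False, symmetric]) blast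
        finally show ?thesis .
      qed
      have 2: "(\<forall>k\<in>{1..n} - H. Q (of_int (e k))) \<longleftrightarrow> (\<forall>k\<in>{1..n} - H. Q (lam (2 * k) - lam (2 * k - 1)))"
        for Q :: "real \<Rightarrow> bool"
        using e_nH by simp
      show ?thesis
        unfolding A'_def B'_def ball_Un ball_simps(9)
          1[of "-1" "\<lambda>x. v2 x = ereal (of_int \<mu>)"]
          1[of 1 "\<lambda>x. v2 x \<ge> ereal (of_int (\<mu> + 1))"]
          2[of "\<lambda>x. v2 x \<ge> ereal (of_int (\<mu> + 1))"]
        by blast
    qed
    have "t \<in> (if B' = {} then even_times (Gcd (A' \<union> B')) else odd_times (Gcd (A' \<union> B'))) \<longleftrightarrow>
        (\<Omega> (-1) \<noteq> {} \<longrightarrow> t \<in> odd_times (gcd M\<^sub>0 (gcd M\<^sub>1 M\<^sub>X))) \<and>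
        (\<Omega> (-1) = {} \<longrightarrow> t \<in> even_times (gcd M\<^sub>0 (gcd M\<^sub>1 M\<^sub>X)))" if ?c1
      unfolding gcd[OF that] B'_empty by simp
    \<comment> \<open>The gcd identity is available only under \<open>?c1\<close>, hence the
      congruence rule that lets earlier conjuncts be assumed.\<close>
    then show ?thesis
      unfolding main v2 g_def[symmetric] using False by (simp only: simp_thms not_False_eq_True cong: conj_cong)
  next
    case True
    have ME: "M\<^sub>E = Gcd (d ` {1..n})"
      unfolding M\<^sub>E using dE[OF True] by (intro real_gcd_eq_Gcd_image)
    have gcd: "Gcd (A' \<union> B') = M\<^sub>E" if ?c1 using AB[OF that] ME H_all[OF True] by simp
    have empty: "\<Omega> j - H = {}" for j using \<Omega>_sub H_all[OF True] by blast
    have v2: "(\<forall>b\<in>B'. v2 (of_int b) = ereal (of_int \<mu>)) \<and> (\<forall>a\<in>A'. v2 (of_int a) \<ge> ereal (of_int (\<mu> + 1)))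
     \<longleftrightarrow> (\<forall>k\<in>\<Omega> (-1). v2 (real (card X) - real_char_sum (chi k) X) = ereal (of_int \<mu>))
        \<and> (\<forall>k\<in>\<Omega> 1. v2 (real (card X) - real_char_sum (chi k) X) \<ge> ereal (of_int (\<mu> + 1)))" for \<mu> :: int
    proof -
      have 1: "(\<forall>k\<in>\<Omega> j. Q (of_int (d k))) \<longleftrightarrow> (\<forall>k\<in>\<Omega> j. Q (real (card X) - real_char_sum (chi k) X))"
        for Q :: "real \<Rightarrow> bool" and j
        by (intro ball_cong refl arg_cong[where f = Q] dE[OF True, symmetric]) (use \<Omega>_sub in blast)
      show ?thesis
        unfolding A'_def B'_def ball_Un ball_simps(9)
          1[of "-1" "\<lambda>x. v2 x = ereal (of_int \<mu>)"]
          1[of 1 "\<lambda>x. v2 x \<ge> ereal (of_int (\<mu> + 1))"]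
        using H_all[OF True] by simp
    qed
    \<comment> \<open>The common valuation is finite whereas that of 0 is infinite. Under the
      valuation conditions, the second alternative for even times can thus hold only when
      \<open>\<Omega> (-1)\<close> is empty, and the case distinction of the theorem agrees with the
      one on \<open>B'\<close>.\<close>
    have degenerate: "\<Omega> (-1) = {}"
      if "\<forall>k\<in>\<Omega> (-1). v2 (real (card X) - real_char_sum (chi k) X) = ereal (of_int \<mu>)"
        and "\<forall>k\<in>\<Omega> (-1). char_sum (chi k) X = of_nat (card X)" for \<mu> :: int
      using that by (force simp: real_char_sum_def v2_def)
    let ?E = "\<exists>\<mu>::int. (\<forall>k\<in>\<Omega> (-1). v2 (real (card X) - real_char_sum (chi k) X) = ereal (of_int \<mu>))
        \<and> (\<forall>k\<in>\<Omega> 1. v2 (real (card X) - real_char_sum (chi k) X) \<ge> ereal (of_int (\<mu> + 1)))"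
    let ?I = "if \<Omega> (-1) = {} \<or> (\<forall>k\<in>\<Omega> (-1). char_sum (chi k) X = of_nat (card X))
           then t \<in> even_times M\<^sub>E else t \<in> odd_times M\<^sub>E"
    have I: "t \<in> (if B' = {} then even_times M\<^sub>E else odd_times M\<^sub>E) \<longleftrightarrow> ?I" if ?E
    proof (cases "\<Omega> (-1) = {}")
      case False
      then have "\<not> (\<forall>k\<in>\<Omega> (-1). char_sum (chi k) X = of_nat (card X))" using degenerate \<open>?E\<close> by blast
      then show ?thesis using False by (simp only: B'_empty) simp
    qed (simp add: B'_empty)
    have "perfect_state_transfer \<Gamma> (p, i) (q, i) t \<longleftrightarrow> ?c1 \<and> ?E \<and> ?I"
      unfolding main v2
    proof (intro conj_cong refl)
      assume ?c1 ?E
      then show "t \<in> (if B' = {} then even_times (Gcd (A' \<union> B')) else odd_times (Gcd (A' \<union> B'))) \<longleftrightarrow> ?I"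
        using I by (simp only: gcd)
    qed
    moreover have "{1..n} - H = {}" using H_all[OF True] by blast
    ultimately show ?thesis
      using True unfolding g_def by (simp only: empty ball_simps simp_thms not_True_eq_False)
  qed
qed

end
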